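(* Let $G$ be a simple graph on $n$ vertices with at least one edge, and let $0=\mu_1\le\mu_2\le\cdots\le\mu_n$ be the eigenvalues of its Laplacian matrix. Let $a\le b$ be positive integers such that $a<b$ or $bn$ is even. If \[ \frac{\mu_2}{\mu_n}\ge 1-\frac{b}{a(b+1)}, \] then $G$ has an $[a,b]$-factor.
   Context: The Laplacian matrix of $G$ is $L=D-A$ ($D$ diagonal degree matrix, $A$ adjacency matrix); $\mu_i$ is its $i$-th smallest eigenvalue. An $[a,b]$-factor of $G$ is a spanning subgraph $H$ with $a\le d_H(v)\le b$ for every vertex $v$, where $d_H(v)$ is the degree of $v$ in $H$.
   Formalization: The hypothesis a < n is added: as printed the claim fails for complete graphs with a ≥ n (for K_2 with a=2, b=3, μ_2/μ_n=1 but there is no [2,3]-factor), and for a ≥ n no graph on n vertices has an [a,b]-factor. *)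

theory Defs
  imports "HOL-Analysis.Analysis" "HOL-Computational_Algebra.Computational_Algebra"
begin

(* Graphs have a finite type 'v as their vertex set, so n = CARD('v), and are given by
   their edge set; a spanning subgraph of E is a subset of E. *)

definition simple_graph :: "'v set set \<Rightarrow> bool" where
  "simple_graph E \<longleftrightarrow> (\<forall>e\<in>E. card e = 2)"

definition vdegree :: "'v set set \<Rightarrow> 'v \<Rightarrow> nat" where
  "vdegree E v = card {e \<in> E. v \<in> e}"

definition is_factor :: "nat \<Rightarrow> nat \<Rightarrow> 'v set set \<Rightarrow> 'v set set \<Rightarrow> bool" where
  "is_factor a b E H \<longleftrightarrow> H \<subseteq> E \<and> (\<forall>v. a \<le> vdegree H v \<and> vdegree H v \<le> b)"

definition adjacency_matrix :: "'v set set \<Rightarrow> real ^ 'v::finite ^ 'v" where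
  "adjacency_matrix E = (\<chi> u v. if {u, v} \<in> E then 1 else 0)"

definition degree_matrix :: "'v set set \<Rightarrow> real ^ 'v::finite ^ 'v" where
  "degree_matrix E = (\<chi> u v. if u = v then real (vdegree E u) else 0)"

definition laplacian :: "'v set set \<Rightarrow> real ^ 'v::finite ^ 'v" where
  "laplacian E = degree_matrix E - adjacency_matrix E"

(* det (X I - M), computed over the polynomial ring *)
definition charpoly :: "'a::comm_ring_1 ^ 'n::finite ^ 'n \<Rightarrow> 'a poly" where
  "charpoly M = det (\<chi> i j. (if i = j then [:0, 1:] else 0) - [:M $ i $ j:])"

(* mu E i is the i-th smallest eigenvalue, counted with multiplicity, for 1 \<le> i \<le> n.
   The Laplacian is real symmetric, so its characteristic polynomial has n real roots and
   the list below has length n. *)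
definition mu :: "'v::finite set set \<Rightarrow> nat \<Rightarrow> real" where
  "mu E i = sorted_list_of_multiset (proots (charpoly (laplacian E))) ! (i - 1)"

end

theory Submission
  imports Defs "HOL-Library.Disjoint_Sets"
begin

text \<open>
  Applying the bounds \<open>\<mu>\<^sub>2 \<le> x \<bullet> L x / x \<bullet> x \<le> \<mu>\<^sub>n\<close> on the complement of the constants to the (projected)
  vectors \<open>1\<^sub>A - 1\<^sub>B\<close> and \<open>1\<^sub>A + 1\<^sub>B\<close>, which have the same Laplacian form if there are no edges between
  \<open>A\<close> and \<open>B\<close>, bounds separators from below; balancing the components shows that the graph has toughness
  at least \<open>\<mu>\<^sub>2 / (\<mu>\<^sub>n - \<mu>\<^sub>2) \<ge> a - 1 + a / b\<close>. That this toughness forces an \<open>[a, b]\<close>-factor is due to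
  Katerinis and, for \<open>a = b\<close>, to Enomoto, Jackson, Katerinis and Saito. Tutte's perfect matching theorem,
  applied to a graph in which every vertex is replaced by a gadget, yields Lovasz's \<open>(g, f)\<close>-factor
  criterion: without a factor there are disjoint \<open>S\<close> and \<open>T\<close> with
  \<open>b |S| < \<Sum>\<^bsub>v \<in> T\<^esub> (a - d\<^bsub>G - S\<^esub>(v)) + q\<close>, where \<open>q\<close> counts odd components of \<open>G - S - T\<close> and vanishes
  for \<open>a < b\<close>. A greedily chosen independent subset of \<open>T\<close>, separated from the rest by \<open>S\<close> and its
  neighbourhood, contradicts toughness.
\<close>

subsection \<open>Spectral bounds for the Laplacian\<close>

text \<open>With \<open>p = b * (a - 1) + a\<close> one has \<open>a * (b + 1) = p + b\<close>, so
  the hypothesis reads \<open>\<mu>\<^sub>2 / \<mu>\<^sub>n \<ge> p / (p + b)\<close>; this is the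
  origin of \<open>a - 1 + a / b = p / b\<close>. Three obstacles shape the proof. The separation
  bound needs two sides of comparable size, but an odd number of isolated vertices cannot be halved;
  if these are all the vertices outside the separator, their degrees are estimated instead. A Tutte
  set of the gadget graph might cut through gadgets; therefore one of maximal excess is taken, and
  among these a smallest, so that each of its vertices sees three odd members, which is possible
  only if it contains outer and inner sets as a whole. Finally, toughness is silent about separators
  that leave one component: a single vertex is handled by its degree, which is at least
  \<open>a\<close> because its neighbourhood separates it from the rest or because \<open>a\<close>
  is smaller than the number of vertices, and for \<open>a = b\<close> a slack of 2, gained by
  parity, guarantees two components.\<close>

lemma quadratic_nonneg_imp_linear_zero:
  fixes p q :: real
  assumes "\<And>t. 2 * t * p + t\<^sup>2 * q \<ge> 0"
  shows "p = 0"
proof (rule ccontr)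
  assume p: "p \<noteq> 0"
  define c where "c = \<bar>q\<bar> + 1"
  have c: "c > 0" "q < c" "c \<noteq> 0" by (auto simp: c_def)
  have "2 * (- p / c) * p + (- p / c)\<^sup>2 * q \<ge> 0" using assms .
  also have "2 * (- p / c) * p + (- p / c)\<^sup>2 * q = p\<^sup>2 / c\<^sup>2 * (q - 2 * c)"
    using c by (simp add: field_simps power2_eq_square)
  finally have "p\<^sup>2 / c\<^sup>2 * (q - 2 * c) \<ge> 0" .
  moreover have "p\<^sup>2 / c\<^sup>2 > 0" using p c by simp
  ultimately have "q - 2 * c \<ge> 0" by (meson mult_pos_neg not_le)
  with c show False by linarith
qed

text \<open>A maximiser \<open>v\<close> of \<open>x \<bullet> f x\<close> on the unit sphere of
  \<open>S\<close> is critical: along the residual \<open>w = c v - f v\<close> the nonnegative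
  defect \<open>c * (x \<bullet> x) - x \<bullet> f x\<close>, which is zero at \<open>v\<close>,
  acquires the linear term \<open>2 * t * (w \<bullet> w)\<close>, and this must vanish.\<close>

lemma self_adjoint_eigenvector:
  fixes f :: "'a::euclidean_space \<Rightarrow> 'a"
  assumes lin: "linear f" and sa: "\<And>x y. f x \<bullet> y = x \<bullet> f y"
    and S: "subspace S" "f ` S \<subseteq> S" "S \<noteq> {0}"
  obtains v c where "v \<in> S" "norm v = 1" "f v = c *\<^sub>R v"
proof -
  interpret linear f by (rule lin)
  define K where "K = sphere 0 1 \<inter> S"
  have "compact K" unfolding K_def
    by (intro compact_Int_closed compact_sphere closed_subspace S)
  moreover have "K \<noteq> {}"
  proof -
    obtain x where "x \<in> S" "x \<noteq> 0" using S(1,3) subspace_0 by blast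
    then have "(1 / norm x) *\<^sub>R x \<in> K" using S(1) by (auto simp: K_def subspace_scale)
    then show ?thesis by blast
  qed
  moreover have "continuous_on K (\<lambda>x. x \<bullet> f x)"
    by (intro continuous_intros linear_continuous_on linear_conv_bounded_linear[THEN iffD1] lin)
  ultimately obtain v where v: "v \<in> K" "\<And>x. x \<in> K \<Longrightarrow> x \<bullet> f x \<le> v \<bullet> f v"
    using continuous_attains_sup by meson
  define c where "c = v \<bullet> f v"
  have vS: "v \<in> S" "norm v = 1" using v by (auto simp: K_def)
  have bound: "x \<bullet> f x \<le> c * (x \<bullet> x)" if "x \<in> S" for x
  proof (cases "x = 0")
    case False
    have "(1 / norm x) *\<^sub>R x \<in> K" using that False S(1) by (auto simp: K_def subspace_scale)
    from v(2)[OF this] have "(x \<bullet> f x) / (norm x)\<^sup>2 \<le> c"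
      by (simp add: scale c_def power2_eq_square)
    with False show ?thesis by (simp add: divide_le_eq power2_norm_eq_inner)
  qed simp
  define w where "w = c *\<^sub>R v - f v"
  have wS: "w \<in> S" unfolding w_def using S vS by (intro subspace_diff subspace_scale) auto
  have "w \<bullet> w = 0"
  proof (rule quadratic_nonneg_imp_linear_zero)
    fix t :: real
    have "v + t *\<^sub>R w \<in> S" using S vS wS by (intro subspace_add subspace_scale)
    from bound[OF this]
    have "c * ((v + t *\<^sub>R w) \<bullet> (v + t *\<^sub>R w)) - (v + t *\<^sub>R w) \<bullet> f (v + t *\<^sub>R w) \<ge> 0" by simp
    also have "c * ((v + t *\<^sub>R w) \<bullet> (v + t *\<^sub>R w)) - (v + t *\<^sub>R w) \<bullet> f (v + t *\<^sub>R w)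
      = (c * (v \<bullet> v) - v \<bullet> f v) + 2 * t * (c * (v \<bullet> w) - f v \<bullet> w) + t\<^sup>2 * (c * (w \<bullet> w) - w \<bullet> f w)"
      using sa[of v w] by (simp add: add scale algebra_simps inner_commute power2_eq_square)
    also have "c * (v \<bullet> v) - v \<bullet> f v = 0"
      using vS by (simp add: c_def flip: power2_norm_eq_inner)
    also have "c * (v \<bullet> w) - f v \<bullet> w = w \<bullet> w" by (simp add: w_def inner_diff_left)
    finally show "2 * t * (w \<bullet> w) + t\<^sup>2 * (c * (w \<bullet> w) - w \<bullet> f w) \<ge> 0" by simp
  qed
  then have "f v = c *\<^sub>R v" by (simp add: w_def)
  with vS that show ?thesis by blast
qed

lemma self_adjoint_eigenbasis:
  fixes f :: "'a::euclidean_space \<Rightarrow> 'a"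
  assumes lin: "linear f" and sa: "\<And>x y. f x \<bullet> y = x \<bullet> f y"
  shows "subspace S \<Longrightarrow> f ` S \<subseteq> S \<Longrightarrow>
    \<exists>B\<subseteq>S. pairwise orthogonal B \<and> (\<forall>v\<in>B. norm v = 1 \<and> (\<exists>c. f v = c *\<^sub>R v)) \<and> span B = S"
proof (induction "dim S" arbitrary: S rule: less_induct)
  case less
  show ?case
  proof (cases "S = {0}")
    case True
    then show ?thesis by (intro exI[of _ "{}"]) auto
  next
    case False
    from self_adjoint_eigenvector[OF lin sa less.prems False]
    obtain v c where v: "v \<in> S" "norm v = 1" "f v = c *\<^sub>R v" by metis
    define S' where "S' = {x\<in>S. v \<bullet> x = 0}"
    have sub: "subspace S'" using less.prems(1)
      by (auto simp: S'_def subspace_def inner_add_right)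
    have "v \<bullet> v = 1" using v(2) by (simp flip: power2_norm_eq_inner)
    then have "v \<notin> S'" by (simp add: S'_def)
    moreover have "S' \<subseteq> S" by (auto simp: S'_def)
    ultimately have "S' \<subset> S" using v(1) by blast
    then have "dim S' < dim S"
      using dim_psubset[of S' S] sub less.prems(1) by (simp add: span_eq_iff[THEN iffD2])
    moreover have "f ` S' \<subseteq> S'"
      using less.prems(2) v(3) by (auto simp: S'_def sa[symmetric])
    ultimately obtain B where B: "B \<subseteq> S'" "pairwise orthogonal B"
      "\<forall>v\<in>B. norm v = 1 \<and> (\<exists>c. f v = c *\<^sub>R v)" "span B = S'"
      using less.hyps[of S'] sub by metis
    have "span (insert v B) = S"
    proof
      show "span (insert v B) \<subseteq> S"
        using B(1) v(1) less.prems(1) by (intro span_minimal) (auto simp: S'_def)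
      show "S \<subseteq> span (insert v B)"
      proof
        fix x assume x: "x \<in> S"
        have "x - (v \<bullet> x) *\<^sub>R v \<in> S'"
          using x v less.prems(1) by (auto simp: S'_def inner_diff_right subspace_diff subspace_scale
            simp flip: power2_norm_eq_inner)
        then show "x \<in> span (insert v B)" using B(4) by (auto simp: span_insert)
      qed
    qed
    moreover have "pairwise orthogonal (insert v B)"
      using B(1,2) by (auto simp: pairwise_insert S'_def orthogonal_def inner_commute)
    ultimately show ?thesis
      using B(1,3) v by (intro exI[of _ "insert v B"]) (auto simp: S'_def)
  qed
qed

section \<open>Characteristic polynomials and orthonormal eigenvectors\<close>

lemma sum_poly_const: "(\<Sum>i\<in>A. [:f i:]) = [:\<Sum>i\<in>A. f i:]"
  by (induction A rule: infinite_finite_induct) auto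

text \<open>This links \<open>mu\<close>, defined by polynomial roots, to eigenvectors. Conjugation
  by the orthogonal matrix \<open>Q\<close> of eigenvectors makes the characteristic matrix
  diagonal; \<open>h\<close> lifts real matrices to constant polynomials so that the conjugation
  takes place over the polynomial ring.\<close>

lemma charpoly_orthonormal_eigenvectors:
  fixes M :: "real^'n::finite^'n" and w :: "'n \<Rightarrow> real^'n"
  assumes on: "\<And>i j. w i \<bullet> w j = (if i = j then 1 else 0)"
    and ev: "\<And>i. M *v w i = d i *\<^sub>R w i"
  shows "charpoly M = (\<Prod>i\<in>UNIV. [:- d i, 1:])"
proof -
  define h :: "real^'n^'n \<Rightarrow> real poly^'n^'n" where "h = (\<lambda>A. \<chi> i j. [:A $ i $ j:])"
  have h_mult: "h (A ** B) = h A ** h B" for A B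
    by (simp add: h_def matrix_matrix_mult_def vec_eq_iff sum_poly_const mult.commute)
  have h_one: "h (mat 1) = mat 1" by (simp add: h_def mat_def vec_eq_iff)
  define X :: "real poly^'n^'n" where "X = (\<chi> i j. (if i = j then [:0, 1:] else 0) - [:M $ i $ j:])"
  define Q where "Q = (\<chi> i. w i)"
  have row: "row i Q = w i" for i by (simp add: Q_def row_def vec_eq_iff)
  have QQ: "Q ** transpose Q = mat 1"
    using on by (simp add: Q_def matrix_matrix_mult_def transpose_def mat_def vec_eq_iff inner_vec_def)
  have QMQ: "Q ** M ** transpose Q = (\<chi> i j. if i = j then d i else 0)"
  proof -
    have "(Q ** (M ** transpose Q)) $ i $ j = (if i = j then d i else 0)" for i j
    proof -
      have "(M ** transpose Q) $ k $ j = (M *v w j) $ k" for k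
        by (simp add: matrix_matrix_mult_def transpose_def Q_def matrix_vector_mult_def)
      then have "(Q ** (M ** transpose Q)) $ i $ j = w i \<bullet> (M *v w j)"
        unfolding matrix_matrix_mult_def[of Q] by (simp add: Q_def inner_vec_def)
      then show ?thesis using on by (simp add: ev)
    qed
    then show ?thesis by (simp add: vec_eq_iff flip: matrix_mul_assoc)
  qed
  have conj: "h Q ** X ** h (transpose Q) = (\<chi> i j. if i = j then [:- d i, 1:] else 0)"
  proof -
    have "A ** (\<chi> i j. (if i = j then p else 0) - N $ i $ j) = (\<chi> i j. p * A $ i $ j) - A ** N"
      for A N :: "real poly^'n^'n" and p
    proof -
      have "A $ i $ k * ((if k = j then p else 0) - N $ k $ j)
        = (if k = j then p * A $ i $ k else 0) - A $ i $ k * N $ k $ j" for i j k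
        by (simp add: algebra_simps)
      then show ?thesis by (simp add: matrix_matrix_mult_def vec_eq_iff sum_subtractf)
    qed
    from this[of "h Q" "[:0, 1:]" "h M"]
    have 1: "h Q ** X = (\<chi> i j. [:0, 1:] * h Q $ i $ j) - h Q ** h M"
      by (simp add: X_def h_def)
    have "h Q ** X ** h (transpose Q)
        = (\<chi> i j. [:0,1:] * (h Q ** h (transpose Q)) $ i $ j) - h Q ** h M ** h (transpose Q)"
      unfolding 1 by (simp add: matrix_matrix_mult_def vec_eq_iff sum_subtractf left_diff_distrib
         sum_distrib_left mult.assoc)
    also have "h Q ** h (transpose Q) = mat 1" using QQ h_mult h_one by metis
    also have "h Q ** h M ** h (transpose Q) = h (\<chi> i j. if i = j then d i else 0)"
      using QMQ h_mult by metis
    finally show ?thesis by (auto simp: vec_eq_iff mat_def h_def)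
  qed
  have "h Q ** h (transpose Q) = mat 1" by (simp add: QQ h_one flip: h_mult)
  then have "charpoly M = det (h Q ** h (transpose Q)) * det X"
    by (simp add: charpoly_def X_def)
  also have "\<dots> = det (h Q ** X ** h (transpose Q))"
    by (simp add: det_mul mult_ac)
  also have "\<dots> = (\<Prod>i\<in>UNIV. [:- d i, 1:])"
    unfolding conj by (subst det_diagonal) auto
  finally show ?thesis .
qed

text \<open>One eigenvector is prescribed so that the constants can be split off from the Laplacian
  even when its eigenvalue 0 is multiple. The others come from the invariant hyperplane orthogonal
  to \<open>e\<close>.\<close>

lemma symmetric_matrix_orthonormal_eigenvectors:
  fixes M :: "real^'n::finite^'n" and e :: "real^'n"
  assumes sym: "transpose M = M" and e: "norm e = 1" "M *v e = c *\<^sub>R e"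
  obtains w d i0 where "\<And>i j. w i \<bullet> w j = (if i = j then 1 else (0::real))"
    "\<And>i::'n. M *v w i = d i *\<^sub>R w i" "w i0 = e" "\<And>x. (\<Sum>i\<in>UNIV. (x \<bullet> w i) *\<^sub>R w i) = x"
proof -
  have sa: "(M *v x) \<bullet> y = x \<bullet> (M *v y)" for x y
    by (metis dot_lmul_matrix sym transpose_matrix_vector vector_transpose_matrix)
  define S where "S = {x. e \<bullet> x = 0}"
  have "subspace S" by (simp add: S_def subspace_hyperplane)
  moreover have "(\<lambda>x. M *v x) ` S \<subseteq> S"
    using e by (auto simp: S_def sa[symmetric])
  ultimately obtain B where B: "B \<subseteq> S" "pairwise orthogonal B"
      "\<forall>v\<in>B. norm v = 1 \<and> (\<exists>c. M *v v = c *\<^sub>R v)" "span B = S"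
    using self_adjoint_eigenbasis[of "\<lambda>x. M *v x" S] sa matrix_vector_mul_linear by blast
  define C where "C = insert e B"
  have ee: "e \<bullet> e = 1" using e(1) by (simp flip: power2_norm_eq_inner)
  have po: "pairwise orthogonal C"
    using B(1,2) by (auto simp: C_def pairwise_insert S_def orthogonal_def inner_commute)
  have C: "norm v = 1 \<and> (\<exists>c. M *v v = c *\<^sub>R v)" if "v \<in> C" for v
    using that B(3) e by (auto simp: C_def)
  then have "0 \<notin> C" by force
  then have ind: "independent C" using po by (rule pairwise_orthogonal_independent[rotated])
  have span: "span C = UNIV"
  proof -
    have "x - (e \<bullet> x) *\<^sub>R e \<in> span B" for x
      unfolding B(4) using ee by (simp add: S_def inner_diff_right)
    then show ?thesis by (auto simp: C_def span_insert)
  qed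
  then have "card C = CARD('n)" using ind
    by (metis dim_eq_card_independent dim_span dim_UNIV DIM_cart DIM_real mult.right_neutral)
  moreover have "finite C" using ind by (rule independent_imp_finite)
  ultimately obtain w where w: "bij_betw w (UNIV :: 'n set) C"
    using finite_same_card_bij[of "UNIV :: 'n set" C] by auto
  have wC: "w i \<in> C" for i using w by (auto simp: bij_betw_def)
  define d where "d = (\<lambda>i. SOME c. M *v w i = c *\<^sub>R w i)"
  have on: "w i \<bullet> w j = (if i = j then 1 else 0)" for i j
  proof (cases "i = j")
    case True
    then show ?thesis using C[OF wC[of i]] by (simp flip: power2_norm_eq_inner)
  next
    case False
    then have "w i \<noteq> w j" using w by (auto simp: bij_betw_def inj_on_def)
    then show ?thesis using po wC False by (auto simp: pairwise_def orthogonal_def)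
  qed
  have ex: "(\<Sum>i\<in>UNIV. (x \<bullet> w i) *\<^sub>R w i) = x" for x
  proof -
    define y where "y = x - (\<Sum>i\<in>UNIV. (x \<bullet> w i) *\<^sub>R w i)"
    have "y \<bullet> w j = 0" for j
      by (simp add: y_def inner_diff_left inner_sum_left on if_distrib cong: if_cong)
    then have "orthogonal y v" if "v \<in> C" for v
      using w that by (auto simp: bij_betw_def orthogonal_def)
    then have "orthogonal y y"
      using orthogonal_to_span[of y C y] span by auto
    then show ?thesis by (simp add: orthogonal_def y_def)
  qed
  obtain i0 where "w i0 = e" using w by (auto simp: bij_betw_def C_def) (metis imageE insertI1)
  moreover have "M *v w i = d i *\<^sub>R w i" for i
    unfolding d_def by (rule someI_ex) (use C[OF wC[of i]] in blast)
  ultimately show ?thesis using on ex that by blast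
qed

section \<open>Adjacency and the quadratic form of the Laplacian\<close>

abbreviation adj :: "'v set set \<Rightarrow> 'v \<Rightarrow> 'v \<Rightarrow> bool" where
  "adj E u v \<equiv> {u, v} \<in> E"

lemma simple_graph_irrefl: "simple_graph E \<Longrightarrow> \<not> adj E v v"
  by (auto simp: simple_graph_def)

lemma edges_at_eq_image:
  assumes "simple_graph E"
  shows "{e\<in>E. v \<in> e} = (\<lambda>u. {v, u}) ` {u. adj E v u}"
proof -
  have "\<exists>u. e = {v, u}" if "e \<in> E" "v \<in> e" for e
    using that assms by (auto simp: simple_graph_def card_2_iff doubleton_eq_iff dest!: bspec)
  then show ?thesis by auto
qed

lemma vdegree_eq_card_nbrs: "simple_graph E \<Longrightarrow> vdegree E v = card {u. adj E v u}"
  unfolding vdegree_def edges_at_eq_image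
  by (rule card_image) (auto simp: inj_on_def doubleton_eq_iff)

lemma laplacian_quadratic_form:
  fixes E :: "'v::finite set set"
  assumes "simple_graph E"
  shows "x \<bullet> (laplacian E *v x) = (\<Sum>u\<in>UNIV. \<Sum>v\<in>UNIV. of_bool (adj E u v) * (x $ u - x $ v)\<^sup>2) / 2"
proof -
  define a where "a u v = (of_bool (adj E u v) :: real)" for u v
  have sym: "a u v = a v u" for u v by (simp add: a_def insert_commute)
  have deg: "real (vdegree E u) = (\<Sum>v\<in>UNIV. a u v)" for u
    by (simp add: vdegree_eq_card_nbrs[OF assms] a_def)
  have "x \<bullet> (laplacian E *v x) = (\<Sum>u\<in>UNIV. x $ u * (real (vdegree E u) * x $ u - (\<Sum>v\<in>UNIV. a u v * x $ v)))"
    by (simp add: inner_vec_def laplacian_def matrix_vector_mult_def degree_matrix_def adjacency_matrix_def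
        left_diff_distrib sum_subtractf a_def of_bool_def if_distrib[of "\<lambda>y. y * _"] cong: if_cong)
  also have "\<dots> = (\<Sum>u\<in>UNIV. \<Sum>v\<in>UNIV. a u v * ((x $ u)\<^sup>2 - x $ u * x $ v))"
    by (simp add: deg sum_distrib_left sum_distrib_right right_diff_distrib sum_subtractf power2_eq_square mult_ac)
  finally have eq: "x \<bullet> (laplacian E *v x) = (\<Sum>u\<in>UNIV. \<Sum>v\<in>UNIV. a u v * ((x $ u)\<^sup>2 - x $ u * x $ v))" .
  have "2 * (x \<bullet> (laplacian E *v x)) = (\<Sum>u\<in>UNIV. \<Sum>v\<in>UNIV. a u v * ((x $ u)\<^sup>2 - x $ u * x $ v))
      + (\<Sum>u\<in>UNIV. \<Sum>v\<in>UNIV. a u v * ((x $ v)\<^sup>2 - x $ u * x $ v))"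
    unfolding eq by (subst (2) sum.swap) (simp add: sym mult.commute)
  also have "\<dots> = (\<Sum>u\<in>UNIV. \<Sum>v\<in>UNIV. a u v * (x $ u - x $ v)\<^sup>2)"
    by (simp add: power2_diff algebra_simps flip: sum.distrib)
  finally show ?thesis by (simp add: a_def)
qed

text \<open>\<open>q x\<close> is the squared norm of the projection of \<open>x\<close> onto the
  complement of the constants. Expanded in the eigenvectors other than \<open>w i0\<close>, it meets
  only eigenvalues between \<open>mu E 2\<close> and \<open>mu E CARD('v)\<close>.\<close>

theorem laplacian_eigenvalue_bounds:
  fixes E :: "'v::finite set set"
  assumes E: "simple_graph E" and n: "CARD('v) \<ge> 2"
  defines "q \<equiv> \<lambda>x :: real^'v. x \<bullet> x - (\<Sum>v\<in>UNIV. x $ v)\<^sup>2 / CARD('v)"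
  shows "0 \<le> mu E 2"
    and "mu E 2 * q x \<le> x \<bullet> (laplacian E *v x)"
    and "x \<bullet> (laplacian E *v x) \<le> mu E CARD('v) * q x"
proof -
  let ?L = "laplacian E"
  define e :: "real^'v" where "e = (\<chi> v. 1 / sqrt CARD('v))"
  have pos: "x \<bullet> (?L *v x) \<ge> 0" for x
    by (simp add: laplacian_quadratic_form[OF E] sum_nonneg)
  have sym: "transpose ?L = ?L"
    by (simp add: laplacian_def degree_matrix_def adjacency_matrix_def transpose_def vec_eq_iff insert_commute)
  have "norm e = 1"
    by (simp add: e_def norm_vec_def L2_set_def real_sqrt_divide power_divide)
  moreover have "?L *v e = 0 *\<^sub>R e"
  proof -
    have "(\<Sum>v\<in>UNIV. ?L $ u $ v) = 0" for u
      using vdegree_eq_card_nbrs[OF E, of u]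
      by (simp add: laplacian_def degree_matrix_def adjacency_matrix_def sum_subtractf flip: of_bool_def)
    then show ?thesis
      by (simp add: e_def matrix_vector_mult_def vec_eq_iff flip: sum_divide_distrib)
  qed
  ultimately obtain w d i0 where on: "\<And>i j. w i \<bullet> w j = (if i = j then 1 else (0::real))"
    and ev: "\<And>i::'v. ?L *v w i = d i *\<^sub>R w i" and i0: "w i0 = e"
    and ex: "\<And>x. (\<Sum>i\<in>UNIV. (x \<bullet> w i) *\<^sub>R w i) = x"
    by (rule symmetric_matrix_orthonormal_eigenvectors[OF sym]) blast
  have d: "d i \<ge> 0" for i using pos[of "w i"] by (simp add: ev on)
  have d0: "d i0 = 0" using ev[of i0] i0 \<open>?L *v e = 0 *\<^sub>R e\<close> on[of i0 i0] by auto
  define ds where "ds = sorted_list_of_multiset (image_mset d (mset_set (UNIV - {i0})))"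
  have "proots (charpoly ?L) = (\<Sum>i\<in>UNIV. {#d i#})"
    by (simp add: charpoly_orthonormal_eigenvectors[OF on ev] proots_prod)
  also have "\<dots> = add_mset (d i0) (image_mset d (mset_set (UNIV - {i0})))"
    by (subst sum.remove[of _ i0]) (auto simp: sum_unfold_sum_mset)
  finally have roots: "sorted_list_of_multiset (proots (charpoly ?L)) = insort 0 ds"
    by (simp add: ds_def d0)
  have set_ds: "set ds = d ` (UNIV - {i0})" by (simp add: ds_def)
  have ins: "insort 0 ds = 0 # ds" using set_ds d by (intro insort_is_Cons) auto
  have sorted: "sorted ds" by (simp add: ds_def)
  have len: "length ds = CARD('v) - 1" by (simp add: ds_def flip: size_mset)
  \<comment> \<open>\<open>mu\<close> counts from 1 and \<open>ds\<close> lacks the leading 0 of the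
    constants, so \<open>mu E i\<close> is \<open>ds ! (i - 2)\<close>; both indices are valid
    because there are at least two vertices.\<close>
  have mu2: "mu E 2 = ds ! 0" and mun: "mu E CARD('v) = ds ! (CARD('v) - 2)"
    using n by (simp_all add: mu_def roots ins nth_Cons' numeral_2_eq_2)
  have ds_in: "d i \<in> set ds" if "i \<noteq> i0" for i using that by (auto simp: set_ds)
  have lo: "mu E 2 \<le> d i" and hi: "d i \<le> mu E CARD('v)" if "i \<noteq> i0" for i
  proof -
    from ds_in[OF that] obtain k where k: "k < length ds" "ds ! k = d i" by (auto simp: in_set_conv_nth)
    show "mu E 2 \<le> d i" unfolding mu2 k(2)[symmetric] using k(1) by (intro sorted_nth_mono sorted) auto
    show "d i \<le> mu E CARD('v)" unfolding mun k(2)[symmetric] using k(1) len n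
      by (intro sorted_nth_mono sorted) auto
  qed
  have "ds ! 0 \<in> set ds" using len n by (intro nth_mem) auto
  then show "0 \<le> mu E 2" using d by (auto simp: mu2 set_ds)
  have xx: "x \<bullet> x = (\<Sum>i\<in>UNIV. (x \<bullet> w i)\<^sup>2)"
    using arg_cong[OF ex[of x], of "(\<bullet>) x"] by (simp add: inner_sum_right power2_eq_square)
  have "x \<bullet> e = (\<Sum>v\<in>UNIV. x $ v) / sqrt CARD('v)"
    by (simp add: e_def inner_vec_def sum_divide_distrib)
  then have "(x \<bullet> w i0)\<^sup>2 = (\<Sum>v\<in>UNIV. x $ v)\<^sup>2 / CARD('v)" by (simp add: i0 power_divide)
  then have q: "q x = (\<Sum>i\<in>UNIV - {i0}. (x \<bullet> w i)\<^sup>2)"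
    by (simp add: q_def xx sum.remove[of UNIV i0 "\<lambda>i. (x \<bullet> w i)\<^sup>2"])
  have "x \<bullet> (?L *v x) = (\<Sum>i\<in>UNIV. d i * (x \<bullet> w i)\<^sup>2)"
  proof -
    have "?L *v x = (\<Sum>i\<in>UNIV. (x \<bullet> w i) *\<^sub>R (d i *\<^sub>R w i))"
      using linear_sum[OF matrix_vector_mul_linear[of ?L], of "\<lambda>i. (x \<bullet> w i) *\<^sub>R w i" UNIV]
      by (simp add: ex ev matrix_vector_mult_scaleR)
    then show ?thesis by (simp add: inner_sum_right power2_eq_square mult_ac)
  qed
  then have xLx: "x \<bullet> (?L *v x) = (\<Sum>i\<in>UNIV - {i0}. d i * (x \<bullet> w i)\<^sup>2)"
    by (simp add: sum.remove[of UNIV i0 "\<lambda>i. d i * (x \<bullet> w i)\<^sup>2"] d0)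
  show "mu E 2 * q x \<le> x \<bullet> (?L *v x)"
    unfolding xLx q sum_distrib_left by (intro sum_mono mult_right_mono lo) auto
  show "x \<bullet> (?L *v x) \<le> mu E CARD('v) * q x"
    unfolding xLx q sum_distrib_left by (intro sum_mono mult_right_mono hi) auto
qed

subsection \<open>Toughness\<close>

text \<open>The two test vectors have the same norm, but their coordinate sums are the difference
  and the sum of the sizes of \<open>A\<close> and \<open>B\<close>. Hence the squared norms of
  their projections differ by \<open>4 * card A * card B / n\<close>, which produces the left
  side.\<close>

theorem laplacian_separation:
  fixes E :: "'v::finite set set"
  assumes E: "simple_graph E" and n: "CARD('v) \<ge> 2"
    and AB: "A \<inter> B = {}" and sep: "\<And>u v. u \<in> A \<Longrightarrow> v \<in> B \<Longrightarrow> \<not> adj E u v"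
  shows "4 * mu E 2 * card A * card B
    \<le> (mu E CARD('v) - mu E 2) * (real (card A) + card B) * card (- (A \<union> B))"
proof -
  define x :: "real^'v" where "x = (\<chi> v. of_bool (v \<in> A) - of_bool (v \<in> B))"
  define y :: "real^'v" where "y = (\<chi> v. of_bool (v \<in> A) + of_bool (v \<in> B))"
  define n where "n = real CARD('v)"
  define a b where "a = real (card A)" and "b = real (card B)"
  have c: "real (card (A \<union> B)) = a + b" using AB by (simp add: card_Un_disjoint a_def b_def)
  have npos: "n > 0" by (simp add: n_def)
  have norms: "x \<bullet> x = a + b" "y \<bullet> y = a + b"
  proof -
    have "x $ v * x $ v = of_bool (v \<in> A \<union> B)" "y $ v * y $ v = of_bool (v \<in> A \<union> B)" for v
      using AB by (auto simp: x_def y_def)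
    moreover have "(\<Sum>v\<in>UNIV. of_bool (v \<in> A \<union> B)) = a + b" unfolding c[symmetric]
      by (simp del: Un_iff)
    ultimately show "x \<bullet> x = a + b" "y \<bullet> y = a + b" by (simp_all add: inner_vec_def del: Un_iff)
  qed
  have sums: "(\<Sum>v\<in>UNIV. x $ v) = a - b" "(\<Sum>v\<in>UNIV. y $ v) = a + b"
    by (simp_all add: x_def y_def sum_subtractf sum.distrib a_def b_def)
  have "of_bool (adj E u v) * (x $ u - x $ v)\<^sup>2 = of_bool (adj E u v) * (y $ u - y $ v)\<^sup>2" for u v
    using AB sep[of u v] sep[of v u] by (auto simp: x_def y_def insert_commute)
  then have "x \<bullet> (laplacian E *v x) = y \<bullet> (laplacian E *v y)"
    by (simp add: laplacian_quadratic_form[OF E])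
  then have "mu E 2 * (a + b - (a - b)\<^sup>2 / n) \<le> mu E CARD('v) * (a + b - (a + b)\<^sup>2 / n)"
    using laplacian_eigenvalue_bounds(2)[OF assms(1,2), of x]
      laplacian_eigenvalue_bounds(3)[OF assms(1,2), of y]
    by (simp add: norms sums n_def)
  then have "n * (mu E 2 * (a + b - (a - b)\<^sup>2 / n)) \<le> n * (mu E CARD('v) * (a + b - (a + b)\<^sup>2 / n))"
    using npos by (intro mult_left_mono) auto
  moreover have "n * (m * (p - q / n)) = m * (n * p - q)" for m p q
    using npos by (simp add: field_simps)
  ultimately have "mu E 2 * (n * (a + b) - (a - b)\<^sup>2) \<le> mu E CARD('v) * (n * (a + b) - (a + b)\<^sup>2)"
    by simp
  then have "4 * mu E 2 * a * b \<le> (mu E CARD('v) - mu E 2) * (a + b) * (n - (a + b))"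
    by (simp add: algebra_simps power2_eq_square)
  moreover have "real (card (- (A \<union> B))) = n - (a + b)"
    by (simp add: Compl_eq_Diff_UNIV card_Diff_subset of_nat_diff card_mono n_def c del: Compl_Un)
  ultimately show ?thesis by (simp add: a_def b_def)
qed

text \<open>The members need not be connected: they are unions of components of the graph without \<open>X\<close>.\<close>

definition closed_family :: "('v \<Rightarrow> 'v \<Rightarrow> bool) \<Rightarrow> 'v set \<Rightarrow> 'v set set \<Rightarrow> bool" where
  "closed_family g X F \<longleftrightarrow> disjoint F \<and> {} \<notin> F \<and>
    (\<forall>A\<in>F. A \<inter> X = {} \<and> (\<forall>u\<in>A. \<forall>v. g u v \<longrightarrow> v \<in> A \<union> X))"

lemma card_le_card_Union:
  assumes "disjoint F" "{} \<notin> F" "finite (\<Union>F)"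
  shows "card F \<le> card (\<Union>F)"
proof -
  have fin: "finite A" if "A \<in> F" for A using that assms(3) by (meson Union_upper finite_subset)
  have "card F = (\<Sum>A\<in>F. 1)" by simp
  also have "\<dots> \<le> (\<Sum>A\<in>F. card A)"
  proof (rule sum_mono)
    fix A assume "A \<in> F"
    then have "A \<noteq> {}" "finite A" using assms(2) fin by auto
    then show "1 \<le> card A" by (simp add: Suc_le_eq card_gt_0_iff)
  qed
  also have "\<dots> = card (\<Union>F)" using assms(1) fin by (subst card_Union_disjoint) (auto simp: disjoint_def)
  finally show ?thesis .
qed

text \<open>\<open>4 * x * y / (x + y)\<close> is twice the harmonic mean of \<open>x\<close> and
  \<open>y\<close>, hence at least twice the smaller one. With \<open>x\<close> and \<open>y\<close>
  the sizes of two sides and \<open>c\<close> the number of separated members, this turns separation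
  into toughness.\<close>

lemma two_min_mult_le:
  fixes x y c m k s :: real
  assumes "4 * m * x * y \<le> k * (x + y) * s" "0 \<le> m" "c \<le> 2 * x" "c \<le> 2 * y" "0 < x" "0 < y"
  shows "m * c \<le> k * s"
proof -
  have "c * (x + y) \<le> 4 * x * y"
  proof (cases "x \<le> y")
    case True
    have "c * (x + y) \<le> (2 * x) * (2 * y)" using assms True
      by (intro mult_mono) auto
    then show ?thesis by simp
  next
    case False
    have "c * (x + y) \<le> (2 * y) * (2 * x)" using assms False
      by (intro mult_mono) auto
    then show ?thesis by (simp add: mult_ac)
  qed
  then have "m * (c * (x + y)) \<le> m * (4 * x * y)" using assms(2) by (rule mult_left_mono)
  with assms(1) have "(m * c) * (x + y) \<le> (k * s) * (x + y)" by (simp add: mult_ac)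
  then show ?thesis using assms(5,6) by (simp add: mult_le_cancel_right)
qed

text \<open>The members and the leftover vertices \<open>Z\<close> are distributed over two sides
  with at least \<open>card F / 2\<close> vertices each. One spare vertex, in \<open>Z\<close> or in
  a member of size at least 2, makes up for an odd \<open>card F\<close>. Without a spare vertex the
  complement of \<open>X\<close> is an independent set of \<open>card F\<close> vertices.\<close>

theorem laplacian_toughness:
  fixes E :: "'v::finite set set"
  assumes E: "simple_graph E" and F: "closed_family (adj E) X F" "card F \<ge> 2"
  shows "mu E 2 * card F \<le> (mu E CARD('v) - mu E 2) * card X"
proof -
  define Z where "Z = - X - \<Union>F"
  have FX: "\<Union>F \<inter> X = {}" and dis: "disjoint F" and ne: "{} \<notin> F"
    and cl: "\<And>A u v. A \<in> F \<Longrightarrow> u \<in> A \<Longrightarrow> adj E u v \<Longrightarrow> v \<in> A \<union> X"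
    using F by (auto simp: closed_family_def)
  have finF: "finite F" by simp
  have dis': "disjoint G" if "G \<subseteq> F" for G using that dis by (auto simp: disjoint_def)
  have "2 \<le> card (\<Union>F)" using card_le_card_Union[OF dis ne] F(2) by simp
  also have "\<dots> \<le> CARD('v)" by (rule card_mono) auto
  finally have n: "CARD('v) \<ge> 2" .
  note m = laplacian_eigenvalue_bounds(1)[OF E n]
  have split: ?thesis if G: "G \<subseteq> F" "card F \<le> 2 * card (\<Union>G)" "card F \<le> 2 * (card (\<Union>(F - G) \<union> Z))" for G
  proof -
    let ?A = "\<Union>G" and ?B = "\<Union>(F - G) \<union> Z"
    have AB: "?A \<inter> ?B = {}" using G(1) dis by (fastforce simp: Z_def disjoint_def)
    have sep: "\<not> adj E u v" if uv: "u \<in> ?A" "v \<in> ?B" for u v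
    proof
      assume "adj E u v"
      moreover obtain A where "A \<in> G" "u \<in> A" using uv(1) by auto
      ultimately have "v \<in> ?A \<union> X" using cl G(1) by blast
      then show False using uv(2) AB FX by (auto simp: Z_def)
    qed
    have "- (?A \<union> ?B) = X" using G(1) FX by (auto simp: Z_def)
    from laplacian_separation[OF E n AB sep, unfolded this]
    have "4 * mu E 2 * card ?A * card ?B \<le> (mu E CARD('v) - mu E 2) * (real (card ?A) + card ?B) * card X" .
    moreover have "real (card F) \<le> 2 * real (card ?A)" "real (card F) \<le> 2 * real (card ?B)"
      using G(2,3) by linarith+
    ultimately show ?thesis using F(2) m
      by - (rule two_min_mult_le, (assumption | linarith)+)
  qed
  consider (Z) "Z \<noteq> {}" | (big) M where "M \<in> F" "card M \<ge> 2" | (single) "Z = {}" "\<And>M. M \<in> F \<Longrightarrow> card M = 1"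
  proof -
    have "card M \<ge> 1" if "M \<in> F" for M using that ne by (auto simp: Suc_le_eq card_gt_0_iff)
    then show ?thesis using that by (metis One_nat_def Suc_1 Suc_leI le_neq_implies_less)
  qed
  then show ?thesis
  proof cases
    case Z
    obtain G where G: "G \<subseteq> F" "card G = card F - card F div 2"
      using obtain_subset_with_card_n[of "card F - card F div 2" F] by auto
    have 1: "card G \<le> card (\<Union>G)"
      using G(1) dis' ne by (intro card_le_card_Union) auto
    have "card (F - G) = card F div 2" using G finF by (simp add: card_Diff_subset finite_subset)
    moreover have "card (F - G) \<le> card (\<Union>(F - G))"
      using dis' ne by (intro card_le_card_Union) auto
    moreover have "card (\<Union>(F - G) \<union> Z) = card (\<Union>(F - G)) + card Z"
      by (intro card_Un_disjoint) (auto simp: Z_def)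
    moreover have "card Z \<ge> 1" using Z by (simp add: Suc_le_eq card_gt_0_iff)
    ultimately show ?thesis using 1 G by (intro split[of G]) linarith+
  next
    case big
    \<comment> \<open>\<open>M\<close> joins the side with the smaller number of members, and its
      second vertex compensates for the rounding.\<close>
    have "card F div 2 - 1 \<le> card (F - {M})" using big(1) by simp
    then obtain G0 where G0: "G0 \<subseteq> F - {M}" "card G0 = card F div 2 - 1"
      using obtain_subset_with_card_n[of "card F div 2 - 1" "F - {M}"] by auto
    define G where "G = insert M G0"
    have GF: "G \<subseteq> F" using G0 big by (auto simp: G_def)
    have "finite G0" "M \<notin> G0" using G0 finF finite_subset by auto
    then have cG: "card G = card F div 2" using G0(2) F(2) by (simp add: G_def)
    have "card (\<Union>G) = card M + card (\<Union>G0)"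
      unfolding G_def Union_insert
    proof (rule card_Un_disjoint)
      show "M \<inter> \<Union>G0 = {}" using G0(1) big(1) dis by (auto simp: disjoint_def)
    qed auto
    moreover have "card G0 \<le> card (\<Union>G0)"
      using GF dis' ne by (intro card_le_card_Union) (auto simp: G_def)
    ultimately have 1: "card F \<le> 2 * card (\<Union>G)" using big(2) G0(2) by linarith
    have "card (F - G) \<le> card (\<Union>(F - G))"
      using dis' ne by (intro card_le_card_Union) auto
    also have "\<dots> \<le> card (\<Union>(F - G) \<union> Z)" by (rule card_mono) auto
    finally have "card F - card F div 2 \<le> card (\<Union>(F - G) \<union> Z)"
      using GF cG finF by (simp add: card_Diff_subset finite_subset)
    then show ?thesis using 1 GF by (intro split[of G]) linarith+
  next
    case single
    define I where "I = \<Union>F"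
    define c where "c = real (card I)"
    define s where "s = real (card X)"
    define \<mu> \<nu> where "\<mu> = mu E 2" and "\<nu> = mu E CARD('v)"
    have cI: "card I = card F"
      using single(2) dis unfolding I_def by (subst card_Union_disjoint) (auto simp: disjoint_def)
    have XI: "- I = X" using single(1) FX by (auto simp: Z_def I_def)
    have indep: "\<not> adj E u v" if uv: "u \<in> I" "v \<in> I" for u v
    proof
      assume a: "adj E u v"
      obtain A where "A \<in> F" "u \<in> A" using uv by (auto simp: I_def)
      then have "v \<in> A" using cl[OF _ _ a] XI uv(2) by blast
      then have "u = v" using single(2)[OF \<open>A \<in> F\<close>] \<open>u \<in> A\<close> by (auto simp: card_1_singleton_iff)
      then show False using a simple_graph_irrefl[OF E] by auto
    qed
    define deg where "deg u = (\<Sum>v\<in>UNIV. of_bool (adj E u v) :: real)" for u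
    have form: "x \<bullet> (laplacian E *v x) = (\<Sum>u\<in>I. deg u * (x $ u)\<^sup>2)" if x: "\<And>v. v \<notin> I \<Longrightarrow> x $ v = 0" for x
    proof -
      have *: "of_bool (adj E u v) * (x $ u - x $ v)\<^sup>2
         = of_bool (adj E u v) * (x $ u)\<^sup>2 + of_bool (adj E v u) * (x $ v)\<^sup>2" for u v
        using x[of u] x[of v] indep[of u v] by (cases "u \<in> I"; cases "v \<in> I") (auto simp: insert_commute)
      have "x \<bullet> (laplacian E *v x) = (\<Sum>u\<in>UNIV. deg u * (x $ u)\<^sup>2)"
      proof -
        have "(\<Sum>u\<in>UNIV. \<Sum>v\<in>UNIV. of_bool (adj E v u) * (x $ v)\<^sup>2) = (\<Sum>u\<in>UNIV. deg u * (x $ u)\<^sup>2)"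
          by (subst sum.swap) (simp add: deg_def sum_distrib_right)
        then show ?thesis
          unfolding laplacian_quadratic_form[OF E] * by (simp add: sum.distrib deg_def sum_distrib_right)
      qed
      also have "\<dots> = (\<Sum>u\<in>I. deg u * (x $ u)\<^sup>2)"
        using x by (intro sum.mono_neutral_right) auto
      finally show ?thesis .
    qed
    have c2: "c \<ge> 2" using F(2) cI by (simp add: c_def)
    \<comment> \<open>The test vector is the difference of two unit vectors. Averaging over all
      pairs of distinct vertices of \<open>I\<close> then bounds the mean degree in \<open>I\<close>
      from below by the second eigenvalue, and the indicator vector of \<open>I\<close> bounds it
      from above.\<close>
    have pair: "2 * \<mu> \<le> deg u + deg v" if uv: "u \<in> I" "v \<in> I" "u \<noteq> v" for u v
    proof -
      define x where "x = axis u (1::real) - axis v 1"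
      have "(\<Sum>w\<in>UNIV. x $ w) = 0" by (simp add: x_def sum_subtractf axis_def)
      moreover have "x \<bullet> x = 2" using uv(3)
        by (simp add: x_def inner_diff_left inner_diff_right inner_axis_axis)
      moreover have "x \<bullet> (laplacian E *v x) = deg u + deg v"
      proof -
        have "x \<bullet> (laplacian E *v x) = (\<Sum>w\<in>I. deg w * (x $ w)\<^sup>2)"
          using uv by (intro form) (auto simp: x_def axis_def)
        also have "\<dots> = (\<Sum>w\<in>{u, v}. deg w * (x $ w)\<^sup>2)"
          using uv by (intro sum.mono_neutral_right) (auto simp: x_def axis_def)
        finally show ?thesis using uv(3) by (simp add: x_def axis_def)
      qed
      ultimately show ?thesis using laplacian_eigenvalue_bounds(2)[OF E n, of x]
        by (simp add: \<mu>_def mult.commute)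
    qed
    have "c * \<mu> \<le> (\<Sum>u\<in>I. deg u)"
    proof -
      have "(\<Sum>u\<in>I. \<Sum>v\<in>I. if u = v then 0 else 2 * \<mu>) \<le> (\<Sum>u\<in>I. \<Sum>v\<in>I. if u = v then 0 else deg u + deg v)"
        using pair by (intro sum_mono) auto
      also have "\<dots> = (\<Sum>u\<in>I. \<Sum>v\<in>I. deg u + deg v - (if u = v then 2 * deg u else 0))"
        by (intro sum.cong) auto
      also have "\<dots> = 2 * (c - 1) * (\<Sum>u\<in>I. deg u)"
        by (simp add: sum_subtractf sum.distrib c_def algebra_simps flip: sum_distrib_left sum_distrib_right)
      also have "(\<Sum>u\<in>I. \<Sum>v\<in>I. if u = v then 0 else 2 * \<mu>) = (\<Sum>u\<in>I. \<Sum>v\<in>I. 2 * \<mu> - (if u = v then 2 * \<mu> else 0))"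
        by (intro sum.cong) auto
      also have "\<dots> = 2 * (c - 1) * (c * \<mu>)"
        by (simp add: sum_subtractf c_def algebra_simps)
      finally show ?thesis using c2 by simp
    qed
    moreover have "(\<Sum>u\<in>I. deg u) \<le> \<nu> * (c - c\<^sup>2 / (c + s))"
    proof -
      define x :: "real^'v" where "x = (\<chi> v. of_bool (v \<in> I))"
      have "(\<Sum>w\<in>UNIV. x $ w) = c" "x \<bullet> x = c" by (simp_all add: x_def c_def inner_vec_def)
      moreover have "x \<bullet> (laplacian E *v x) = (\<Sum>u\<in>I. deg u)"
        by (subst form) (auto simp: x_def)
      moreover have "real CARD('v) = c + s"
        using card_Diff_subset[of I UNIV] card_mono[of UNIV I] XI by (simp add: c_def s_def Compl_eq_Diff_UNIV of_nat_diff)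
      ultimately show ?thesis
        using laplacian_eigenvalue_bounds(3)[OF E n, of x] by (simp add: \<nu>_def)
    qed
    ultimately have "c * \<mu> \<le> \<nu> * (c - c\<^sup>2 / (c + s))" by linarith
    also have "c - c\<^sup>2 / (c + s) = c * (s / (c + s))"
    proof -
      have "c + s > 0" using c2 by (simp add: s_def add_pos_nonneg)
      then show ?thesis by (simp add: field_simps power2_eq_square)
    qed
    finally have "c * \<mu> \<le> c * (\<nu> * (s / (c + s)))" by (simp add: mult_ac)
    then have "\<mu> \<le> \<nu> * (s / (c + s))" using c2 by (subst (asm) mult_le_cancel_left_pos) auto
    moreover have "c + s > 0" using c2 by (simp add: s_def add_pos_nonneg)
    ultimately have "\<mu> * (c + s) \<le> \<nu> * s" by (simp add: field_simps)
    then have "\<mu> * c \<le> (\<nu> - \<mu>) * s" by (simp add: algebra_simps)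
    then show ?thesis by (simp add: \<mu>_def \<nu>_def c_def s_def cI)
  qed
qed

subsection \<open>Tutte's perfect matching theorem\<close>

definition perfect_matching :: "'a set \<Rightarrow> ('a \<Rightarrow> 'a \<Rightarrow> bool) \<Rightarrow> ('a \<Rightarrow> 'a) \<Rightarrow> bool" where
  "perfect_matching V R m \<longleftrightarrow> (\<forall>x\<in>V. m x \<in> V \<and> m (m x) = x \<and> R x (m x))"

lemma even_card_involution:
  assumes "finite A" "\<And>x. x \<in> A \<Longrightarrow> m x \<in> A \<and> m (m x) = x \<and> m x \<noteq> x"
  shows "even (card A)"
  using assms
proof (induction "card A" arbitrary: A rule: less_induct)
  case less
  show ?case
  proof (cases "A = {}")
    case False
    then obtain x where x: "x \<in> A" by blast
    let ?B = "A - {x, m x}"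
    have c: "card {x, m x} = 2" "{x, m x} \<subseteq> A" using less.prems(2)[OF x] x by auto
    then have B: "card A = card ?B + 2"
      using card_mono[OF less.prems(1) c(2)] by (simp add: card_Diff_subset)
    have "even (card ?B)"
    proof (rule less.hyps)
      show "m y \<in> ?B \<and> m (m y) = y \<and> m y \<noteq> y" if "y \<in> ?B" for y
      proof -
        have "y \<in> A" "y \<noteq> x" "y \<noteq> m x" using that by auto
        with less.prems(2)[of y] less.prems(2)[OF x] show ?thesis by auto
      qed
    qed (use B less.prems in auto)
    then show ?thesis using B by simp
  qed simp
qed

lemma perfect_matching_even_card:
  assumes "finite V" "irreflp R" "perfect_matching V R m"
  shows "even (card V)"
  using assms by (intro even_card_involution[of V m]) (auto simp: perfect_matching_def irreflp_def)

lemma perfect_matching_UN: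
  assumes "disjoint_family_on A I" "\<And>i. i \<in> I \<Longrightarrow> \<exists>m. perfect_matching (A i) R m"
  shows "\<exists>m. perfect_matching (\<Union>i\<in>I. A i) R m"
proof -
  from assms(2) obtain m where m: "\<And>i. i \<in> I \<Longrightarrow> perfect_matching (A i) R (m i)" by metis
  define ix where "ix x = (THE i. i \<in> I \<and> x \<in> A i)" for x
  have ix: "ix x = i" if "i \<in> I" "x \<in> A i" for x i
    unfolding ix_def using that assms(1) by (intro the_equality) (auto simp: disjoint_family_on_def)
  have "perfect_matching (\<Union>i\<in>I. A i) R (\<lambda>x. m (ix x) x)"
    unfolding perfect_matching_def
  proof
    fix x assume "x \<in> (\<Union>i\<in>I. A i)"
    then obtain i where i: "i \<in> I" "x \<in> A i" by blast
    with m[OF i(1)] have "m i x \<in> A i" "m i (m i x) = x" "R x (m i x)"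
      by (auto simp: perfect_matching_def)
    then show "m (ix x) x \<in> (\<Union>i\<in>I. A i) \<and> m (ix (m (ix x) x)) (m (ix x) x) = x \<and> R x (m (ix x) x)"
      using ix[OF i] ix[OF i(1), of "m i x"] i(1) by auto
  qed
  then show ?thesis by blast
qed

lemma perfect_matching_Un:
  assumes "A \<inter> B = {}" "perfect_matching A R m" "perfect_matching B R m'"
  shows "\<exists>m. perfect_matching (A \<union> B) R m"
proof -
  have "\<exists>m. perfect_matching (\<Union>b\<in>UNIV. if b then A else B) R m"
    using assms by (intro perfect_matching_UN) (auto simp: disjoint_family_on_def)
  then show ?thesis by (simp add: UNIV_bool Un_commute)
qed

lemma perfect_matching_pair:
  assumes "symp R" "R x y"
  shows "perfect_matching {x, y} R (\<lambda>z. if z = x then y else x)"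
  using assms by (auto simp: perfect_matching_def symp_def)

lemma perfect_matching_clique:
  assumes "finite A" "even (card A)" "symp R" "\<And>x y. x \<in> A \<Longrightarrow> y \<in> A \<Longrightarrow> x \<noteq> y \<Longrightarrow> R x y"
  shows "\<exists>m. perfect_matching A R m"
  using assms
proof (induction "card A" arbitrary: A rule: less_induct)
  case less
  show ?case
  proof (cases "A = {}")
    case False
    then obtain x where x: "x \<in> A" by blast
    have "A \<noteq> {x}" using less.prems(2) by auto
    then obtain y where y: "y \<in> A" "y \<noteq> x" using x by blast
    let ?B = "A - {x, y}"
    have B: "card A = card ?B + 2"
      using card_mono[OF less.prems(1), of "{x, y}"] x y by (simp add: card_Diff_subset)
    then obtain m where "perfect_matching ?B R m"
      using less.hyps[of ?B] less.prems by auto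
    moreover have "perfect_matching {x, y} R (\<lambda>z. if z = x then y else x)"
      using less.prems(3,4) x y by (intro perfect_matching_pair) auto
    ultimately obtain m' where "perfect_matching (?B \<union> {x, y}) R m'"
      using perfect_matching_Un[of ?B "{x, y}"] by blast
    moreover have "?B \<union> {x, y} = A" using x y by auto
    ultimately show ?thesis by auto
  next
    case True
    then show ?thesis by (intro exI[of _ id]) (simp add: perfect_matching_def)
  qed
qed

text \<open>Follow the walk \<open>d, m1 d, m2 (m1 d), \<dots>\<close> in the symmetric difference of the two matchings.
  If it meets \<open>{a, c}\<close>, stop there and close up through \<open>b\<close>; otherwise switch on the whole cycle.
  That \<open>b\<close> does not lie on the walk prematurely is a matter of parity.\<close>

lemma perfect_matching_exchange:
  assumes fin: "finite V" and R: "symp R" "irreflp R"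
    and V: "a \<in> V" "b \<in> V" "c \<in> V" "d \<in> V" and ab: "R a b" and bc: "R b c"
    and m1: "\<And>x. x \<in> V \<Longrightarrow> m1 x \<in> V \<and> m1 (m1 x) = x \<and> m1 x \<noteq> x \<and> (R x (m1 x) \<or> {x, m1 x} = {a, c})"
    and m2: "\<And>x. x \<in> V \<Longrightarrow> m2 x \<in> V \<and> m2 (m2 x) = x \<and> m2 x \<noteq> x \<and> (R x (m2 x) \<or> {x, m2 x} = {b, d})"
    and ac: "m1 a = c" and bd: "m2 b = d"
  shows "\<exists>m. perfect_matching V R m"
proof -
  define y where "y i = ((m2 \<circ> m1) ^^ i) d" for i
  have y0: "y 0 = d" and yS: "y (Suc i) = m2 (m1 (y i))" for i by (simp_all add: y_def)
  have yV: "y i \<in> V" for i using V m1 m2 by (induction i) (auto simp: y0 yS)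
  have inv1: "m1 x \<in> V" "m1 (m1 x) = x" "m1 x \<noteq> x" if "x \<in> V" for x using m1[OF that] by auto
  have inv2: "m2 x \<in> V" "m2 (m2 x) = x" "m2 x \<noteq> x" if "x \<in> V" for x using m2[OF that] by auto
  have ca: "m1 c = a" and db: "m2 d = b" using inv1(2)[OF V(1)] inv2(2)[OF V(2)] ac bd by auto
  have sym: "R x z \<longleftrightarrow> R z x" for x z using R(1) by (auto simp: symp_def)
  have neq: "a \<noteq> b" "c \<noteq> b" using ab bc R(2) by (auto simp: irreflp_def)
  define Y where "Y J = y ` J \<union> m1 ` y ` J" for J
  have YV: "Y J \<subseteq> V" for J using yV inv1 by (auto simp: Y_def)
  have finY: "finite (Y J)" for J using YV fin finite_subset by metis
  have Y1: "m1 x \<in> Y J" if "x \<in> Y J" for x J using that inv1(2)[OF yV] by (auto simp: Y_def)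
  have evenY: "even (card (Y J))" for J
    using Y1 inv1 YV finY by (intro even_card_involution[of _ m1]) blast+
  have acY: "a \<notin> Y J \<and> c \<notin> Y J" if "\<And>j. j \<in> J \<Longrightarrow> y j \<notin> {a, c}" for J
  proof -
    have "m1 (y j) \<notin> {a, c}" if j: "j \<in> J" for j
      using \<open>\<And>j. j \<in> J \<Longrightarrow> y j \<notin> {a, c}\<close>[OF j] inv1(2)[OF yV[of j]] ac ca by auto
    with that show ?thesis by (fastforce simp: Y_def)
  qed
  have RY: "R x (m1 x)" if "x \<in> Y J" "a \<notin> Y J \<and> c \<notin> Y J" for x J
    using m1[of x] YV that by (auto simp: doubleton_eq_iff)
  show ?thesis
  proof (cases "\<exists>i. y i \<in> {a, c}")
    case True
    define i where "i = (LEAST i. y i \<in> {a, c})"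
    define e where "e = y i"
    have e: "e \<in> {a, c}" unfolding e_def i_def using True by (rule LeastI_ex)
    define J where "J = {..<i}"
    have "y j \<notin> {a, c}" if "j \<in> J" for j using that not_less_Least unfolding J_def i_def by blast
    then have acJ: "a \<notin> Y J \<and> c \<notin> Y J" by (rule acY)
    then have eJ: "e \<notin> Y J" using e by auto
    have eb: "e \<noteq> b" using e neq by auto
    have Reb: "R e b" "R b e" using e ab bc sym by auto
    have closed2: "m2 x \<in> insert e (insert b (Y J))" if "x \<in> insert e (insert b (Y J))" for x
    proof -
      have y_in: "y j \<in> insert e (Y J)" if "j \<le> i" for j
        using that by (auto simp: e_def Y_def J_def le_less)
      have m2y: "m2 (y j) \<in> insert b (Y J)" if "j \<le> i" for j
      proof (cases j)
        case 0
        then show ?thesis by (simp add: y0 db)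
      next
        case (Suc k)
        then have "m2 (y j) = m1 (y k)" by (simp add: yS inv2 inv1 yV)
        then show ?thesis using that Suc by (auto simp: Y_def J_def)
      qed
      consider "x = e" | "x = b" | j where "j < i" "x = y j" | j where "j < i" "x = m1 (y j)"
        using \<open>x \<in> insert e (insert b (Y J))\<close> by (auto simp: Y_def J_def)
      then show ?thesis
      proof cases
        case 1
        then show ?thesis using m2y[of i] by (auto simp: e_def)
      next
        case 2
        then show ?thesis using y_in[of 0] bd y0 by auto
      next
        case 3
        then show ?thesis using m2y[of j] by auto
      next
        case 4
        then have "m2 x = y (Suc j)" by (simp add: yS)
        then show ?thesis using y_in[of "Suc j"] 4 by auto
      qed
    qed
    have eV: "e \<in> V" using yV by (simp add: e_def)
    \<comment> \<open>If \<open>b\<close> were on the walk, \<open>m2\<close> would pair up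
      \<open>insert e (Y J)\<close>, which has one element more than the union \<open>Y J\<close> of
      pairs of \<open>m1\<close>.\<close>
    have bJ: "b \<notin> Y J"
    proof
      assume b: "b \<in> Y J"
      have "even (card (insert e (Y J)))"
      proof (rule even_card_involution[of _ m2])
        show "m2 x \<in> insert e (Y J) \<and> m2 (m2 x) = x \<and> m2 x \<noteq> x" if "x \<in> insert e (Y J)" for x
          using closed2[of x] that b inv2[of x] YV[of J] eV by (auto simp: insert_absorb)
      qed (use finY in auto)
      then show False using eJ finY evenY[of J] by simp
    qed
    define m where "m x = (if x \<in> Y J then m1 x else if x = e then b else if x = b then e else m2 x)" for x
    have "perfect_matching V R m"
      unfolding perfect_matching_def
    proof
      fix x assume x: "x \<in> V"
      consider "x \<in> Y J" | "x = e" | "x = b" | "x \<notin> insert e (insert b (Y J))" by blast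
      then show "m x \<in> V \<and> m (m x) = x \<and> R x (m x)"
      proof cases
        case 1
        then show ?thesis using Y1[OF 1] RY[OF 1 acJ] inv1[OF x] by (simp add: m_def)
      next
        case 4
        have "m2 x \<notin> insert e (insert b (Y J))" using closed2[of "m2 x"] 4 inv2(2)[OF x] by auto
        moreover have "R x (m2 x)" using m2[OF x] 4 bd \<open>m2 x \<notin> _\<close> by (auto simp: doubleton_eq_iff)
        ultimately show ?thesis using 4 inv2[OF x] by (simp add: m_def)
      qed (use eJ bJ eb V eV Reb in \<open>auto simp: m_def\<close>)
    qed
    then show ?thesis by blast
  next
    case False
    then have acJ: "a \<notin> Y UNIV \<and> c \<notin> Y UNIV" by (intro acY) auto
    have closed2: "m2 x \<in> insert b (Y UNIV)" if x: "x \<in> insert b (Y UNIV)" for x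
    proof -
      consider "x = b" | "x = y 0" | j where "x = y (Suc j)" | j where "x = m1 (y j)"
      proof -
        from x consider "x = b" | j where "x = y j" | j where "x = m1 (y j)" by (auto simp: Y_def)
        then show ?thesis
        proof cases
          case (2 j)
          then show ?thesis using that by (cases j) auto
        qed (use that in blast)+
      qed
      then show ?thesis
      proof cases
        case 3
        then have "m2 x = m1 (y j)" by (simp add: yS inv2 inv1 yV)
        then show ?thesis by (auto simp: Y_def)
      next
        case 4
        then have "m2 x = y (Suc j)" by (simp add: yS)
        then show ?thesis by (auto simp: Y_def)
      qed (auto simp: y0 db bd Y_def intro: rev_image_eqI[of 0])
    qed
    have bJ: "b \<in> Y UNIV"
    proof (rule ccontr)
      assume b: "b \<notin> Y UNIV"
      have "even (card (insert b (Y UNIV)))"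
      proof (rule even_card_involution[of _ m2])
        show "m2 x \<in> insert b (Y UNIV) \<and> m2 (m2 x) = x \<and> m2 x \<noteq> x" if "x \<in> insert b (Y UNIV)" for x
          using closed2[OF that] that inv2[of x] YV[of UNIV] V(2) by auto
      qed (use finY in auto)
      then show False using b finY evenY[of UNIV] by simp
    qed
    define m where "m x = (if x \<in> Y UNIV then m1 x else m2 x)" for x
    have "perfect_matching V R m"
      unfolding perfect_matching_def
    proof
      fix x assume x: "x \<in> V"
      show "m x \<in> V \<and> m (m x) = x \<and> R x (m x)"
      proof (cases "x \<in> Y UNIV")
        case True
        then show ?thesis using Y1[OF True] RY[OF True acJ] inv1[OF x] by (simp add: m_def)
      next
        case False
        have "m2 x \<notin> Y UNIV" using closed2[of "m2 x"] False inv2(2)[OF x] bJ by (auto simp: insert_absorb)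
        moreover have "R x (m2 x)" using m2[OF x] False bJ \<open>m2 x \<notin> _\<close> by (auto simp: doubleton_eq_iff)
        ultimately show ?thesis using False inv2[OF x] by (simp add: m_def)
      qed
    qed
    then show ?thesis by blast
  qed
qed

section \<open>Tutte sets and Tutte's theorem by edge-maximality\<close>

definition odd_family :: "'a set \<Rightarrow> ('a \<Rightarrow> 'a \<Rightarrow> bool) \<Rightarrow> 'a set \<Rightarrow> 'a set set \<Rightarrow> bool" where
  "odd_family V R W F \<longleftrightarrow> W \<subseteq> V \<and> disjoint F \<and>
    (\<forall>K\<in>F. K \<subseteq> V - W \<and> odd (card K) \<and> (\<forall>x\<in>K. \<forall>y\<in>V. R x y \<longrightarrow> y \<in> K \<union> W))"

lemma tutte_transitive_case:
  assumes fin: "finite V" and ev: "even (card V)" and R: "symp R" "irreflp R"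
  defines "U \<equiv> {u\<in>V. \<forall>x\<in>V. x \<noteq> u \<longrightarrow> R u x}"
  assumes tr: "\<And>a b c. a \<in> V - U \<Longrightarrow> b \<in> V - U \<Longrightarrow> c \<in> V - U \<Longrightarrow> R a b \<Longrightarrow> R b c \<Longrightarrow> a \<noteq> c \<Longrightarrow> R a c"
    and nopm: "\<And>m. \<not> perfect_matching V R m"
  obtains F where "odd_family V R U F" "card U < card F"
proof -
  define cls where "cls x = {y \<in> V - U. y = x \<or> R x y}" for x
  define C where "C = cls ` (V - U)"
  define F where "F = {K\<in>C. odd (card K)}"
  have UV: "U \<subseteq> V" by (auto simp: U_def)
  then have finU: "finite U" using fin finite_subset by blast
  have sym: "R x z \<longleftrightarrow> R z x" for x z using R(1) by (auto simp: symp_def)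
  have cls_eq: "cls x = cls z" if "x \<in> V - U" "z \<in> V - U" "x = z \<or> R x z" for x z
    using that tr[of x z] tr[of z x] sym unfolding cls_def by blast
  have disC: "K = L" if KL: "K \<in> C" "L \<in> C" "x \<in> K" "x \<in> L" for K L x
  proof -
    obtain p q where "p \<in> V - U" "K = cls p" "q \<in> V - U" "L = cls q"
      using KL(1,2) by (auto simp: C_def)
    moreover from this KL(3,4) have "x \<in> V - U" "p = x \<or> R p x" "q = x \<or> R q x"
      by (auto simp: cls_def)
    ultimately show ?thesis using cls_eq[of p x] cls_eq[of q x] by simp
  qed
  have CU: "\<Union>C = V - U" by (auto simp: C_def cls_def)
  have finC: "finite C" using fin by (simp add: C_def)
  have finK: "finite K" if "K \<in> C" for K using that fin by (auto simp: C_def cls_def)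
  have clique: "R x z" if "K \<in> C" "x \<in> K" "z \<in> K" "x \<noteq> z" for K x z
  proof -
    obtain w where w: "w \<in> V - U" "K = cls w" using \<open>K \<in> C\<close> by (auto simp: C_def)
    with that have "x \<in> V - U" "z \<in> V - U" "x = w \<or> R x w" "z = w \<or> R w z"
      using sym by (auto simp: cls_def)
    then show ?thesis using tr[of x w z] that(4) w by blast
  qed
  have "odd_family V R U F"
    unfolding odd_family_def
  proof (intro conjI ballI impI)
    show "disjoint F" using disC unfolding disjoint_def F_def by blast
    fix K assume K: "K \<in> F"
    then show "K \<subseteq> V - U" "odd (card K)" using CU by (auto simp: F_def)
    fix x y assume xy: "x \<in> K" "y \<in> V" "R x y"
    then show "y \<in> K \<union> U" using K cls_eq[of _ x] xy by (auto simp: F_def C_def cls_def)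
  qed (rule UV)
  moreover have "card U < card F"
  proof (rule ccontr)
    assume "\<not> card U < card F"
    then have "card F \<le> card U" by simp
    moreover have finF: "finite F" using finC by (simp add: F_def)
    ultimately obtain \<phi> where \<phi>: "inj_on \<phi> F" "\<phi> ` F \<subseteq> U"
      using finU card_le_inj by metis
    have "\<exists>x. x \<in> K" if "K \<in> F" for K using that by (auto simp: F_def C_def cls_def)
    then obtain k where k: "\<And>K. K \<in> F \<Longrightarrow> k K \<in> K" by metis
    have kVU: "k K \<in> V - U" if "K \<in> F" for K using k[OF that] CU that by (auto simp: F_def)
    have k_inj: "K = L" if "K \<in> F" "L \<in> F" "k K = k L" for K L
      using that k disC unfolding F_def by (metis (mono_tags, lifting) mem_Collect_eq)
    have "\<exists>m. perfect_matching (\<Union>K\<in>F. {k K, \<phi> K}) R m"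
    proof (rule perfect_matching_UN)
      show "disjoint_family_on (\<lambda>K. {k K, \<phi> K}) F"
        unfolding disjoint_family_on_def
      proof (intro ballI impI)
        fix K L assume KL: "K \<in> F" "L \<in> F" "K \<noteq> L"
        then have "k K \<noteq> k L" "\<phi> K \<noteq> \<phi> L" using k_inj \<phi>(1) by (auto simp: inj_on_def)
        moreover have "k K \<noteq> \<phi> L" "k L \<noteq> \<phi> K" using kVU[OF KL(1)] kVU[OF KL(2)] \<phi>(2) KL by auto
        ultimately show "{k K, \<phi> K} \<inter> {k L, \<phi> L} = {}" by auto
      qed
      fix K assume K: "K \<in> F"
      then have "\<phi> K \<in> U" "k K \<in> V" "k K \<noteq> \<phi> K" using kVU[OF K] \<phi>(2) by auto
      then have "R (\<phi> K) (k K)" by (auto simp: U_def)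
      then have "R (k K) (\<phi> K)" using sym by blast
      then show "\<exists>m. perfect_matching {k K, \<phi> K} R m" using perfect_matching_pair[OF R(1)] by blast
    qed
    then obtain m1 where m1: "perfect_matching (\<Union>K\<in>F. {k K, \<phi> K}) R m1" ..
    have "\<exists>m. perfect_matching (\<Union>K\<in>C. K - k ` F) R m"
    proof (rule perfect_matching_UN)
      show "disjoint_family_on (\<lambda>K. K - k ` F) C" using disC unfolding disjoint_family_on_def by blast
      fix K assume K: "K \<in> C"
      have "k L \<notin> K" if L: "L \<in> F" "L \<noteq> K" for L
        using disC[of L K "k L"] k[OF L(1)] L K by (auto simp: F_def)
      then have "K - k ` F = (if K \<in> F then K - {k K} else K)"
        by auto
      then have "even (card (K - k ` F))"
        using K finK[OF K] k[of K] by (auto simp: F_def)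
      then show "\<exists>m. perfect_matching (K - k ` F) R m"
        using K finK[OF K] clique by (intro perfect_matching_clique R) auto
    qed
    then obtain m2 where m2: "perfect_matching (\<Union>K\<in>C. K - k ` F) R m2" ..
    let ?A = "\<Union>K\<in>F. {k K, \<phi> K}" and ?B = "\<Union>K\<in>C. K - k ` F"
    have B: "?B = V - U - k ` F" using CU by auto
    have A: "?A = k ` F \<union> \<phi> ` F" by auto
    have "?A \<inter> ?B = {}" unfolding A B using \<phi>(2) by auto
    then obtain m3 where m3: "perfect_matching (?A \<union> ?B) R m3"
      using perfect_matching_Un m1 m2 by metis
    have AB: "?A \<union> ?B \<subseteq> V" "V - (?A \<union> ?B) \<subseteq> U" unfolding A B using kVU \<phi>(2) UV by auto
    then have "even (card (?A \<union> ?B))"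
      using m3 R(2) fin by (intro perfect_matching_even_card) (auto intro: finite_subset)
    moreover have "card (V - (?A \<union> ?B)) = card V - card (?A \<union> ?B)"
      using AB(1) fin by (intro card_Diff_subset) (auto intro: finite_subset)
    ultimately have "even (card (V - (?A \<union> ?B)))"
      using ev by (simp only: dvd_diff_nat)
    then have "\<exists>m. perfect_matching (V - (?A \<union> ?B)) R m"
    proof (rule perfect_matching_clique[rotated])
      show "R x y" if xy: "x \<in> V - (?A \<union> ?B)" "y \<in> V - (?A \<union> ?B)" "x \<noteq> y" for x y
      proof -
        have "x \<in> U" "y \<in> V" using xy(1,2) AB(2) by blast+
        with xy(3) show ?thesis by (auto simp: U_def)
      qed
    qed (use fin R(1) in auto)
    then obtain m4 where m4: "perfect_matching (V - (?A \<union> ?B)) R m4" ..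
    have "(?A \<union> ?B) \<union> (V - (?A \<union> ?B)) = V" using AB by blast
    then show False
      using perfect_matching_Un[OF _ m3 m4] nopm by auto
  qed
  ultimately show ?thesis by (rule that)
qed

text \<open>A barrier survives the removal of an edge, so by induction on the number of non-adjacent
  pairs every added edge may be assumed to create a perfect matching. If \<open>b\<close> were a
  common neighbour of non-adjacent \<open>a\<close> and \<open>c\<close>, all outside
  \<open>U\<close>, it would have a non-neighbour \<open>d\<close>, and exchanging the matchings for
  \<open>{a, c}\<close> and \<open>{b, d}\<close> would give one without new edges.\<close>

theorem tutte_perfect_matching:
  assumes "finite V" "even (card V)" "symp R" "irreflp R" "\<And>m. \<not> perfect_matching V R m"
  shows "\<exists>W F. odd_family V R W F \<and> card W < card F"
  using assms
proof (induction "card {(x, y) \<in> V \<times> V. \<not> R x y}" arbitrary: R rule: less_induct)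
  case less
  note fin = less.prems(1) and sym = less.prems(3) and irr = less.prems(4)
  define add where "add x y = (\<lambda>u v. R u v \<or> {u, v} = {x, y})" for x y
  show ?case
  proof (cases "\<exists>x\<in>V. \<exists>y\<in>V. x \<noteq> y \<and> \<not> R x y \<and> (\<forall>m. \<not> perfect_matching V (add x y) m)")
    case True
    then obtain x y where xy: "x \<in> V" "y \<in> V" "x \<noteq> y" "\<not> R x y" "\<And>m. \<not> perfect_matching V (add x y) m"
      by blast
    have "card {(u, v) \<in> V \<times> V. \<not> add x y u v} < card {(u, v) \<in> V \<times> V. \<not> R u v}"
    proof (rule psubset_card_mono)
      show "finite {(u, v) \<in> V \<times> V. \<not> R u v}" by (rule finite_subset[of _ "V \<times> V"]) (use fin in auto)
    qed (use xy in \<open>auto simp: add_def\<close>)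
    moreover have "symp (add x y)" "irreflp (add x y)"
      using sym irr xy(3) by (auto simp: add_def symp_def irreflp_def doubleton_eq_iff)
    ultimately obtain W F where "odd_family V (add x y) W F" "card W < card F"
      using less.hyps[of "add x y"] less.prems xy(5) by blast
    moreover from this(1) have "odd_family V R W F"
      by (auto simp: odd_family_def add_def)
    ultimately show ?thesis by blast
  next
    case False
    then have pm: "\<exists>m. perfect_matching V (add x y) m" if "x \<in> V" "y \<in> V" "x \<noteq> y" "\<not> R x y" for x y
      using that by blast
    define U where "U = {u\<in>V. \<forall>x\<in>V. x \<noteq> u \<longrightarrow> R u x}"
    have tr: "R a c" if abc: "a \<in> V - U" "b \<in> V - U" "c \<in> V - U" "R a b" "R b c" "a \<noteq> c" for a b c
    proof (rule ccontr)
      assume nac: "\<not> R a c"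
      obtain d where d: "d \<in> V" "d \<noteq> b" "\<not> R b d" using abc(2) by (auto simp: U_def)
      obtain m1 where m1: "perfect_matching V (add a c) m1" using pm[of a c] abc nac by auto
      obtain m2 where m2: "perfect_matching V (add b d) m2" using pm[of b d] abc d by auto
      have uses: "m x = y" if m: "perfect_matching V (add x y) m" and xy: "x \<in> V" "y \<in> V" for m x y
      proof (rule ccontr)
        assume *: "m x \<noteq> y"
        have "R u (m u)" if "u \<in> V" for u
          using m that * xy unfolding perfect_matching_def add_def by (metis doubleton_eq_iff)
        then have "perfect_matching V R m" using m by (auto simp: perfect_matching_def)
        then show False using less.prems(5) by blast
      qed
      have "\<exists>m. perfect_matching V R m"
      proof (rule perfect_matching_exchange[OF fin sym irr, of a b c d m1 m2])
        show "m1 a = c" using uses[OF m1] abc by auto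
        show "m2 b = d" using uses[OF m2] abc d by auto
        show "m1 x \<in> V \<and> m1 (m1 x) = x \<and> m1 x \<noteq> x \<and> (R x (m1 x) \<or> {x, m1 x} = {a, c})" if "x \<in> V" for x
          using m1 that irr abc(6) unfolding perfect_matching_def add_def irreflp_def
          by (metis doubleton_eq_iff)
        show "m2 x \<in> V \<and> m2 (m2 x) = x \<and> m2 x \<noteq> x \<and> (R x (m2 x) \<or> {x, m2 x} = {b, d})" if "x \<in> V" for x
          using m2 that irr d(2) unfolding perfect_matching_def add_def irreflp_def
          by (metis doubleton_eq_iff)
      qed (use abc d in auto)
      then show False using less.prems(5) by blast
    qed
    obtain F where "odd_family V R U F" "card U < card F"
    proof (rule tutte_transitive_case[OF fin less.prems(2) sym irr, folded U_def])
      show "R a c" if "a \<in> V - U" "b \<in> V - U" "c \<in> V - U" "R a b" "R b c" "a \<noteq> c" for a b c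
        using that by (rule tr)
    qed (rule less.prems(5))
    then show ?thesis by blast
  qed
qed

section \<open>Barriers of maximal excess\<close>

lemma even_sum_odd_iff:
  assumes "finite F" "\<And>K. K \<in> F \<Longrightarrow> odd (f K :: nat)"
  shows "even (\<Sum>K\<in>F. f K) \<longleftrightarrow> even (card F)"
  using assms by (induction F rule: finite_induct) auto

lemma odd_family_same_member:
  assumes "odd_family V R W F" "symp R" "K \<in> F" "R x y" "x \<in> V - W" "y \<in> V - W"
  shows "x \<in> K \<longleftrightarrow> y \<in> K"
proof -
  have "v \<in> K \<union> W" if "u \<in> K" "v \<in> V" "R u v" for u v
    using assms(1,3) that unfolding odd_family_def by meson
  moreover have "R y x" using assms(2,4) by (rule sympD)
  ultimately show ?thesis using assms(4-6) by blast
qed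

text \<open>Among the families of maximal excess take one with \<open>W\<close> minimal. If some \<open>x \<in> W\<close> met at most two
  members, merging these, \<open>x\<close> and the uncovered vertices would give a better one.\<close>

theorem tutte_extremal_barrier:
  assumes fin: "finite V" and ev: "even (card V)" and sym: "symp R" and irr: "irreflp R"
    and nopm: "\<And>m. \<not> perfect_matching V R m"
  obtains W F where "odd_family V R W F" "card W + 2 \<le> card F"
    "\<And>x. x \<in> W \<Longrightarrow> 3 \<le> card {K\<in>F. \<exists>y\<in>K. R x y}"
proof -
  define n where "n = int (card V)"
  \<comment> \<open>A lexicographic order in one integer: first the excess
    \<open>card F - card W\<close>, then small \<open>card W\<close>. The factor
    \<open>n + 1\<close> dominates because \<open>card W \<le> n\<close>.\<close>
  define key where "key = (\<lambda>(W :: 'a set, F :: 'a set set). (n + 1) * (int (card F) - int (card W)) - int (card W))"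
  define P where "P = {(W, F). odd_family V R W F}"
  have "P \<subseteq> Pow V \<times> Pow (Pow V)" by (auto simp: P_def odd_family_def)
  then have finP: "finite P" using fin finite_subset by (metis finite_Pow_iff finite_cartesian_product)
  obtain W0 F0 where WF0: "odd_family V R W0 F0" "card W0 < card F0"
    using tutte_perfect_matching[OF assms] by blast
  then have P0: "(W0, F0) \<in> P" by (simp add: P_def)
  define p where "p = (SOME p. p \<in> P \<and> key p = Max (key ` P))"
  have "\<exists>p. p \<in> P \<and> key p = Max (key ` P)"
    using Max_in[of "key ` P"] finP P0 by fastforce
  then have p: "p \<in> P" "key p = Max (key ` P)" unfolding p_def by (metis (mono_tags, lifting) someI_ex)+
  obtain W F where WF: "p = (W, F)" by fastforce
  have of: "odd_family V R W F" using p WF by (simp add: P_def)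
  have max: "key (W', F') \<le> key (W, F)" if "odd_family V R W' F'" for W' F'
    using p WF finP that by (simp add: P_def)
  have WV: "W \<subseteq> V" and dis: "disjoint F" and FK: "\<And>K. K \<in> F \<Longrightarrow> K \<subseteq> V - W" "\<And>K. K \<in> F \<Longrightarrow> odd (card K)"
    and cl: "\<And>K x y. K \<in> F \<Longrightarrow> x \<in> K \<Longrightarrow> y \<in> V \<Longrightarrow> R x y \<Longrightarrow> y \<in> K \<union> W"
    using of unfolding odd_family_def by auto
  have symR: "R x y \<longleftrightarrow> R y x" for x y using sym by (auto simp: symp_def)
  have finW: "finite W" using WV fin finite_subset by blast
  have finF: "finite F" using FK(1) fin by (intro finite_subset[of F "Pow V"]) auto
  have finK: "finite K" if "K \<in> F" for K using FK(1)[OF that] fin finite_subset by blast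
  have "card W0 \<le> card V" using WF0 fin by (intro card_mono) (auto simp: odd_family_def)
  moreover have "n + 1 \<le> (n + 1) * (int (card F0) - int (card W0))"
    using WF0(2) by (simp add: n_def)
  ultimately have "0 < key (W0, F0)" unfolding key_def n_def prod.case by linarith
  also have "\<dots> \<le> key (W, F)" by (rule max) (rule WF0)
  finally have "0 < (n + 1) * (int (card F) - int (card W))" by (simp add: key_def)
  then have less: "card W < card F" by (simp add: n_def zero_less_mult_iff)
  define Z where "Z = V - W - \<Union>F"
  have clZ: "y \<in> Z \<union> W" if "x \<in> Z" "y \<in> V" "R x y" for x y
    using that cl[of _ y x] symR[of x y] by (auto simp: Z_def)
  have evZ: "even (card Z)"
  proof (rule ccontr)
    assume odd: "odd (card Z)"
    then have "Z \<noteq> {}" by auto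
    then have nF: "Z \<notin> F" by (auto simp: Z_def)
    have "odd_family V R W (insert Z F)"
      using of odd clZ unfolding odd_family_def disjoint_def by (auto simp: Z_def)
    from max[OF this] have "(n + 1) * (int (card F) + 1 - int (card W)) \<le> (n + 1) * (int (card F) - int (card W))"
      using nF finF by (simp add: key_def add.commute)
    then show False by (simp add: n_def)
  qed
  have hit: "3 \<le> card {K\<in>F. \<exists>y\<in>K. R x y}" if x: "x \<in> W" for x
  proof (rule ccontr)
    define N where "N = {K\<in>F. \<exists>y\<in>K. R x y}"
    assume "\<not> 3 \<le> card {K\<in>F. \<exists>y\<in>K. R x y}"
    then have N2: "card N \<le> 2" by (simp add: N_def)
    have NF: "N \<subseteq> F" by (auto simp: N_def)
    then have finN: "finite N" using finF finite_subset by blast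
    define M where "M = insert x (Z \<union> \<Union>N)"
    have xV: "x \<in> V" using x WV by auto
    have "card M = Suc (card (Z \<union> \<Union>N))"
      unfolding M_def using x NF FK(1) fin finN finK by (subst card_insert_disjoint) (auto simp: Z_def)
    also have "card (Z \<union> \<Union>N) = card Z + card (\<Union>N)"
      using NF fin finN finK by (intro card_Un_disjoint) (auto simp: Z_def)
    also have "card (\<Union>N) = (\<Sum>K\<in>N. card K)"
      using pairwise_subset[OF dis NF] NF finK by (intro card_Union_disjoint) auto
    finally have oddM: "odd (card M) \<longleftrightarrow> even (card N)"
      using even_sum_odd_iff[OF finN, of card] NF FK(2) evZ by auto
    define F' where "F' = (F - N) \<union> (if odd (card M) then {M} else {})"
    have disM: "K \<inter> M = {}" if K: "K \<in> F - N" for K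
    proof -
      have "K \<inter> L = {}" if "L \<in> N" for L
      proof -
        have "L \<in> F" "K \<noteq> L" using that K NF by auto
        then show ?thesis using dis K by (auto simp: disjoint_def)
      qed
      moreover have "x \<notin> K" "K \<inter> Z = {}" using K FK(1)[of K] x by (auto simp: Z_def)
      ultimately show ?thesis by (auto simp: M_def)
    qed
    have "odd_family V R (W - {x}) F'"
      unfolding odd_family_def
    proof (intro conjI ballI impI)
      show "disjoint F'"
        using dis disM unfolding disjoint_def F'_def by (auto simp: Int_commute)
      fix K assume K: "K \<in> F'"
      then consider "K \<in> F" "K \<notin> N" | "K = M" "odd (card M)" by (auto simp: F'_def split: if_splits)
      then have *: "K \<subseteq> V - (W - {x}) \<and> odd (card K) \<and> (\<forall>u\<in>K. \<forall>v\<in>V. R u v \<longrightarrow> v \<in> K \<union> (W - {x}))"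
      proof cases
        case 1
        then show ?thesis using FK[of K] cl[of K] symR unfolding N_def by blast
      next
        case 2
        have "v \<in> M \<union> (W - {x})" if uv: "u \<in> M" "v \<in> V" "R u v" for u v
        proof (cases "u = x")
          case True
          then show ?thesis using uv by (auto simp: M_def Z_def N_def)
        next
          case False
          then show ?thesis using uv clZ[of u v] cl[of _ u v] NF unfolding M_def by blast
        qed
        moreover have "M \<subseteq> V - (W - {x})" using xV NF FK(1) by (auto simp: M_def Z_def)
        ultimately show ?thesis using 2 by auto
      qed
      then show "K \<subseteq> V - (W - {x})" "odd (card K)" by auto
      fix u v assume "u \<in> K" "v \<in> V" "R u v"
      then show "v \<in> K \<union> (W - {x})" using * by blast
    qed (use WV in auto)
    from max[OF this] have "key (W - {x}, F') \<le> key (W, F)" .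
    \<comment> \<open>The merged set \<open>M\<close> has odd size iff \<open>card N\<close> is
      even. So 0, 1 or 2 members are lost and 1, 0 or 1 gained: the number of members drops by at
      most one, as does the size of \<open>W\<close>, and the excess does not decrease.\<close>
    moreover have "int (card F') \<ge> int (card F) - 1"
    proof -
      have "M \<notin> F - N" using disM[of M] by (auto simp: M_def)
      then have "card F' = card (F - N) + (if odd (card M) then 1 else 0)"
        using finF by (auto simp: F'_def)
      moreover have "card (F - N) = card F - card N" using NF finN by (simp add: card_Diff_subset)
      moreover have "card N = 0 \<or> card N = 1 \<or> card N = 2" using N2 by linarith
      ultimately show ?thesis using oddM by auto
    qed
    moreover have "int (card (W - {x})) = int (card W) - 1"
      using card_Suc_Diff1[OF finW x] by linarith
    ultimately have "int (card F) - int (card W) \<le> int (card F') - int (card (W - {x}))" by linarith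
    then have "(n + 1) * (int (card F) - int (card W)) \<le> (n + 1) * (int (card F') - int (card (W - {x})))"
      by (rule mult_left_mono) (simp add: n_def)
    then show False
      using \<open>key (W - {x}, F') \<le> key (W, F)\<close> \<open>int (card (W - {x})) = int (card W) - 1\<close>
      unfolding key_def prod.case by linarith
  qed
  \<comment> \<open>Modulo 2 this says that \<open>W\<close> and \<open>F\<close> have sizes of
    equal parity, which raises the excess from 1 to 2.\<close>
  have "card V = card W + card Z + card (\<Union>F)"
  proof -
    have "V = (W \<union> Z) \<union> \<Union>F" using WV FK(1) by (auto simp: Z_def)
    then have "card V = card ((W \<union> Z) \<union> \<Union>F)" by simp
    also have "\<dots> = card (W \<union> Z) + card (\<Union>F)"
      using finW fin finF finK FK(1) by (intro card_Un_disjoint) (auto simp: Z_def)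
    also have "card (W \<union> Z) = card W + card Z"
      using finW fin by (intro card_Un_disjoint) (auto simp: Z_def)
    finally show ?thesis .
  qed
  also have "card (\<Union>F) = (\<Sum>K\<in>F. card K)"
    using finK dis by (intro card_Union_disjoint) auto
  finally have "even (card W) \<longleftrightarrow> even (card F)"
    using even_sum_odd_iff[OF finF, of card] FK(2) evZ ev by auto
  with less have "card W + 2 \<le> card F"
    by (metis Suc_leI add_2_eq_Suc' even_Suc le_neq_implies_less)
  from of this hit show ?thesis by (rule that)
qed

subsection \<open>The factor criterion\<close>

lemma card_hit_le:
  assumes "disjoint F" "finite P"
  shows "card {K\<in>F. K \<inter> P \<noteq> {}} \<le> card P"
proof -
  define f where "f K = (SOME x. x \<in> K \<inter> P)" for K
  have f: "f K \<in> K \<inter> P" if "K \<inter> P \<noteq> {}" for K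
    using someI_ex[of "\<lambda>x. x \<in> K \<inter> P"] that unfolding f_def by blast
  show ?thesis
  proof (rule card_inj_on_le[of f])
    show "inj_on f {K\<in>F. K \<inter> P \<noteq> {}}"
    proof (rule inj_onI)
      fix K L assume KL: "K \<in> {K\<in>F. K \<inter> P \<noteq> {}}" "L \<in> {K\<in>F. K \<inter> P \<noteq> {}}" "f K = f L"
      then have "f K \<in> K" "f K \<in> L" using f[of K] f[of L] by auto
      then show "K = L" using KL(1,2) assms(1) by (auto simp: disjoint_def)
    qed
    show "f ` {K\<in>F. K \<inter> P \<noteq> {}} \<subseteq> P" using f by auto
  qed (rule assms)
qed

lemma card_Un3:
  assumes "finite A" "finite B" "finite C" "A \<inter> B = {}" "A \<inter> C = {}" "B \<inter> C = {}"
  shows "card (A \<union> B \<union> C) = card A + card B + card C"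
  using assms by (simp add: card_Un_disjoint Int_Un_distrib2)

text \<open>
  Each vertex \<open>v\<close> becomes a complete bipartite graph between \<open>deg v + b\<close> outer vertices (\<open>Half v u\<close> for every
  edge \<open>vu\<close>, and \<open>b\<close> dummies) and \<open>deg v\<close> hard together with \<open>b - a\<close> optional inner vertices; \<open>Half v u\<close> is
  joined to \<open>Half u v\<close>. Matching all hard and any number of optional vertices into the outer ones leaves
  between \<open>a\<close> and \<open>b\<close> outer vertices, to be matched along edges of the graph. All optional vertices form a
  clique, so that the unused ones can be matched among themselves, with \<open>Extra\<close> to correct the parity.
\<close>

datatype 'v gadget_vertex =
  Half 'v 'v | Dummy 'v nat | Hard 'v 'v | Opt 'v nat | Extra

fun link :: "'v gadget_vertex \<Rightarrow> 'v gadget_vertex \<Rightarrow> bool" where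
  "link (Half v u) (Half v' u') \<longleftrightarrow> u = v' \<and> v = u'"
| "link (Half v u) (Hard w z) \<longleftrightarrow> v = w"
| "link (Half v u) (Opt w i) \<longleftrightarrow> v = w"
| "link (Dummy v j) (Hard w z) \<longleftrightarrow> v = w"
| "link (Dummy v j) (Opt w i) \<longleftrightarrow> v = w"
| "link (Opt v i) (Opt w j) \<longleftrightarrow> (v, i) \<noteq> (w, j)"
| "link (Opt v i) Extra \<longleftrightarrow> True"
| "link _ _ \<longleftrightarrow> False"

locale factor_gadget =
  fixes g :: "'v::finite \<Rightarrow> 'v \<Rightarrow> bool" and a b :: nat
  assumes g_sym: "g u v \<Longrightarrow> g v u" and g_irrefl: "\<not> g v v"
    and a_le_b: "a \<le> b" and b_pos: "0 < b" and parity: "a < b \<or> even (b * CARD('v))"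
begin

definition nb :: "'v \<Rightarrow> 'v set" where "nb v = {u. g v u}"

definition outer :: "'v \<Rightarrow> 'v gadget_vertex set" where
  "outer v = Half v ` nb v \<union> Dummy v ` {..<b}"
definition hard :: "'v \<Rightarrow> 'v gadget_vertex set" where
  "hard v = Hard v ` nb v"
definition opts :: "'v \<Rightarrow> 'v gadget_vertex set" where
  "opts v = Opt v ` {..<b - a}"
definition extra :: "'v gadget_vertex set" where
  "extra = (if a < b \<and> odd (a * CARD('v)) then {Extra} else {})"
definition inner :: "'v \<Rightarrow> 'v gadget_vertex set" where
  "inner v = hard v \<union> opts v"
definition hub :: "'v gadget_vertex set" where
  "hub = (\<Union>v. opts v) \<union> extra"
definition vertices :: "'v gadget_vertex set" where
  "vertices = (\<Union>v. outer v \<union> inner v) \<union> extra"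
definition R :: "'v gadget_vertex \<Rightarrow> 'v gadget_vertex \<Rightarrow> bool" where
  "R x y \<longleftrightarrow> x \<in> vertices \<and> y \<in> vertices \<and> (link x y \<or> link y x)"

lemmas set_defs = outer_def hard_def opts_def inner_def extra_def

lemma symp_R: "symp R" by (auto simp: symp_def R_def)

lemma Half_in_outer: "Half v u \<in> outer w \<longleftrightarrow> v = w \<and> g v u"
  by (auto simp: outer_def nb_def)

lemma Half_in_vertices: "Half v u \<in> vertices \<longleftrightarrow> g v u"
  by (simp add: vertices_def Half_in_outer) (auto simp: set_defs)

lemma irreflp_R: "irreflp R"
proof (rule irreflpI)
  fix x show "\<not> R x x"
    by (cases x) (auto simp: R_def Half_in_vertices g_irrefl)
qed

lemma finite_sets [simp]:
  "finite (outer v)" "finite (hard v)" "finite (opts v)" "finite (inner v)" "finite extra"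
  "finite hub" "finite vertices" "finite (nb v)"
  by (auto simp: set_defs hub_def vertices_def)

lemma card_outer: "card (outer v) = card (nb v) + b"
  unfolding outer_def by (subst card_Un_disjoint) (auto simp: card_image inj_on_def)

lemma card_hard: "card (hard v) = card (nb v)"
  unfolding hard_def by (simp add: card_image inj_on_def)

lemma card_opts: "card (opts v) = b - a"
  unfolding opts_def by (simp add: card_image inj_on_def)

lemma card_inner: "card (inner v) = card (nb v) + (b - a)"
  unfolding inner_def
  by (subst card_Un_disjoint) (auto simp: card_hard card_opts, auto simp: set_defs)

lemma outer_disjoint: "v \<noteq> w \<Longrightarrow> outer v \<inter> outer w = {}"
  by (auto simp: set_defs)

lemma inner_disjoint: "v \<noteq> w \<Longrightarrow> inner v \<inter> inner w = {}"
  by (auto simp: set_defs)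

lemma outer_inner_disjoint: "outer v \<inter> inner w = {}"
  by (auto simp: set_defs)

lemma extra_disjoint: "outer v \<inter> extra = {}" "inner v \<inter> extra = {}"
  by (auto simp: set_defs)

lemma R_outer_inner: "x \<in> outer v \<Longrightarrow> y \<in> inner v \<Longrightarrow> R x y"
  by (auto simp: R_def vertices_def) (auto simp: set_defs)

lemma R_hub: "x \<in> hub \<Longrightarrow> y \<in> hub \<Longrightarrow> x \<noteq> y \<Longrightarrow> R x y"
  by (auto simp: R_def vertices_def hub_def inner_def, auto simp: set_defs split: if_splits)

lemma R_Half: "g v u \<Longrightarrow> R (Half v u) (Half u v)"
  using g_sym[of v u] by (simp add: R_def Half_in_vertices)

lemma R_outerD:
  assumes "x \<in> outer v" "R x y"
  shows "y \<in> inner v \<or> (\<exists>u. g v u \<and> x = Half v u \<and> y = Half u v)"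
  using assms by (cases y) (auto simp: R_def vertices_def set_defs nb_def split: if_splits)

lemma R_hardD: "x \<in> hard v \<Longrightarrow> R x y \<Longrightarrow> y \<in> outer v"
  by (cases y) (auto simp: R_def vertices_def set_defs nb_def split: if_splits)

lemma R_optsD: "x \<in> opts v \<Longrightarrow> R x y \<Longrightarrow> y \<in> outer v \<union> hub"
  by (cases y) (auto simp: R_def vertices_def set_defs hub_def nb_def split: if_splits)

lemma R_innerD: "x \<in> inner v \<Longrightarrow> R x y \<Longrightarrow> y \<in> outer v \<union> hub"
  using R_hardD R_optsD unfolding inner_def by blast

lemma R_extraD: "x \<in> extra \<Longrightarrow> R x y \<Longrightarrow> y \<in> hub"
  by (cases y) (auto simp: R_def vertices_def set_defs hub_def split: if_splits)

lemma card_gadget_Union: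
  "card (\<Union>v\<in>U. outer v \<union> inner v) = (\<Sum>v\<in>U. 2 * card (nb v) + b + (b - a))"
proof -
  have "card (\<Union>v\<in>U. outer v \<union> inner v) = (\<Sum>v\<in>U. card (outer v \<union> inner v))"
  proof (rule card_UN_disjoint)
    show "\<forall>v\<in>U. \<forall>w\<in>U. v \<noteq> w \<longrightarrow> (outer v \<union> inner v) \<inter> (outer w \<union> inner w) = {}"
      using outer_disjoint inner_disjoint outer_inner_disjoint by blast
  qed auto
  also have "\<dots> = (\<Sum>v\<in>U. 2 * card (nb v) + b + (b - a))"
    by (subst card_Un_disjoint) (auto simp: outer_inner_disjoint card_outer card_inner intro!: sum.cong)
  finally show ?thesis .
qed

text \<open>Modulo 2 every gadget contributes \<open>a\<close>. For \<open>a < b\<close> an odd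
  total is corrected by \<open>Extra\<close>; for \<open>a = b\<close> it is even by
  \<open>parity\<close>.\<close>

lemma even_card_vertices: "even (card vertices)"
proof -
  have "card vertices = card (\<Union>v. outer v \<union> inner v) + card extra"
    unfolding vertices_def using extra_disjoint by (intro card_Un_disjoint) auto
  also have "card (\<Union>v. outer v \<union> inner v) = 2 * (\<Sum>v\<in>UNIV. card (nb v)) + CARD('v) * (2 * b - a)"
  proof -
    have "2 * c + b + (b - a) = 2 * c + (2 * b - a)" for c using a_le_b by simp
    then show ?thesis by (simp only: card_gadget_Union) (simp add: sum.distrib sum_distrib_left)
  qed
  finally show ?thesis using parity a_le_b by (auto simp: extra_def)
qed

text \<open>Let \<open>P\<close> be the outer vertices of \<open>v\<close> matched inside its
  gadget. It contains the partners of all hard vertices and is no larger than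
  \<open>inner v\<close>, so \<open>card P\<close> lies between \<open>card (nb v)\<close> and
  \<open>card (nb v) + (b - a)\<close>; the other outer vertices are half edges matched to their
  opposites.\<close>

lemma factor_of_perfect_matching:
  assumes "perfect_matching vertices R m"
  obtains h where "\<And>u v. h u v \<Longrightarrow> g u v" "\<And>u v. h u v \<Longrightarrow> h v u"
    "\<And>v. a \<le> card {u. h v u} \<and> card {u. h v u} \<le> b"
proof -
  define h where "h v u \<longleftrightarrow> g v u \<and> m (Half v u) = Half u v" for v u
  have m: "m x \<in> vertices" "m (m x) = x" "R x (m x)" if "x \<in> vertices" for x
    using assms that by (auto simp: perfect_matching_def)
  have sub: "outer v \<subseteq> vertices" "inner v \<subseteq> vertices" for v by (auto simp: vertices_def)
  have "h u v" if "h v u" for u v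
  proof -
    have "Half v u \<in> vertices" using that by (auto simp: h_def vertices_def set_defs nb_def)
    then show ?thesis using m(2)[of "Half v u"] that g_sym by (auto simp: h_def)
  qed
  moreover have "a \<le> card {u. h v u} \<and> card {u. h v u} \<le> b" for v
  proof -
    define P where "P = {x\<in>outer v. m x \<in> inner v}"
    have "outer v = Half v ` {u. h v u} \<union> P"
    proof
      show "outer v \<subseteq> Half v ` {u. h v u} \<union> P"
      proof
        fix x assume x: "x \<in> outer v"
        then have "R x (m x)" using m(3) sub(1) by blast
        from R_outerD[OF x this] show "x \<in> Half v ` {u. h v u} \<union> P"
          using x by (auto simp: P_def h_def)
      qed
      show "Half v ` {u. h v u} \<union> P \<subseteq> outer v" by (auto simp: P_def h_def outer_def nb_def)
    qed
    moreover have "Half v ` {u. h v u} \<inter> P = {}" by (auto simp: P_def h_def set_defs)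
    moreover have finP: "finite P" by (auto simp: P_def)
    ultimately have "card (outer v) = card (Half v ` {u. h v u}) + card P"
      by (simp add: card_Un_disjoint)
    then have cP: "card (nb v) + b = card {u. h v u} + card P"
      by (simp add: card_outer card_image inj_on_def)
    have injm: "inj_on m vertices" by (rule inj_on_inverseI[of _ m]) (rule m(2))
    have "card P \<le> card (inner v)"
      using sub injm by (intro card_inj_on_le[of m]) (auto simp: P_def intro: inj_on_subset)
    moreover have "card (hard v) \<le> card P"
    proof (rule card_inj_on_le[of m])
      show "inj_on m (hard v)" using sub(2)[of v] by (intro inj_on_subset[OF injm]) (auto simp: inner_def)
      show "m ` hard v \<subseteq> P"
      proof
        fix y assume "y \<in> m ` hard v"
        then obtain x where x: "x \<in> hard v" "y = m x" by blast
        then have xV: "x \<in> vertices" using sub(2) by (auto simp: inner_def)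
        have "y \<in> outer v" using R_hardD[OF x(1)] m(3)[OF xV] x(2) by auto
        moreover have "m y \<in> inner v" using m(2)[OF xV] x by (auto simp: inner_def)
        ultimately show "y \<in> P" by (simp add: P_def)
      qed
    qed (rule finP)
    ultimately show ?thesis using cP a_le_b unfolding card_inner card_hard by linarith
  qed
  moreover have "g u v" if "h u v" for u v using that by (simp add: h_def)
  ultimately show ?thesis using that by blast
qed

section \<open>From Tutte sets of the gadget graph to factor barriers\<close>

definition out_degree :: "'v set \<Rightarrow> 'v \<Rightarrow> nat" where
  "out_degree S v = card {u. g v u \<and> u \<notin> S}"

text \<open>For disjoint sets this is the number of edges between them. Likewise
  \<open>out_degree\<close> refers to no orientation: it is the degree after the deletion of
  \<open>S\<close>.\<close>

definition touching :: "'v set \<Rightarrow> 'v set \<Rightarrow> nat" where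
  "touching C T = (\<Sum>u\<in>C. card {v\<in>T. g u v})"

text \<open>For \<open>a = b\<close> the two sides of the final inequality have the same parity, whence the slack 2.\<close>

definition factor_barrier :: "'v set \<Rightarrow> 'v set \<Rightarrow> 'v set set \<Rightarrow> bool" where
  "factor_barrier S T C \<longleftrightarrow> S \<inter> T = {} \<and> disjoint C \<and> (a < b \<longrightarrow> C = {}) \<and>
    (\<forall>K\<in>C. K \<inter> (S \<union> T) = {} \<and> odd (b * card K + touching K T) \<and>
       (\<forall>u\<in>K. \<forall>v. g u v \<longrightarrow> v \<in> K \<union> S \<union> T)) \<and>
    b * card S + (\<Sum>v\<in>T. out_degree S v) + (if a < b then 1 else 2) \<le> a * card T + card C"

text \<open>\<open>W\<close> has to respect the gadgets. The neighbours of a gadget vertex lie in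
  two blocks (an outer or inner set, the hub, or one opposite half edge). A block whose vertices
  outside \<open>W\<close> are pairwise adjacent, or have a common neighbour outside
  \<open>W\<close>, meets at most one member, whereas every vertex of \<open>W\<close> sees three.
  So \<open>W\<close> consists of whole outer sets, over \<open>S\<close>, and whole inner sets,
  over \<open>T\<close>.\<close>

theorem factor_or_barrier:
  assumes nofactor: "\<And>h. (\<And>u v. h u v \<Longrightarrow> g u v) \<Longrightarrow> (\<And>u v. h u v \<Longrightarrow> h v u) \<Longrightarrow>
    (\<And>v. a \<le> card {u. h v u} \<and> card {u. h v u} \<le> b) \<Longrightarrow> False"
  shows "\<exists>S T C. factor_barrier S T C"
proof -
  have nopm: "\<not> perfect_matching vertices R m" for m
    using factor_of_perfect_matching[of m] nofactor by metis
  obtain W F where WF: "odd_family vertices R W F" "card W + 2 \<le> card F"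
    and three: "\<And>x. x \<in> W \<Longrightarrow> 3 \<le> card {K\<in>F. \<exists>y\<in>K. R x y}"
    using tutte_extremal_barrier[OF _ even_card_vertices symp_R irreflp_R nopm] by auto
  have WV: "W \<subseteq> vertices" and dis: "disjoint F" and FK: "\<And>K. K \<in> F \<Longrightarrow> K \<subseteq> vertices - W"
    and oddK: "\<And>K. K \<in> F \<Longrightarrow> odd (card K)"
    using WF(1) unfolding odd_family_def by auto
  have RV: "x \<in> vertices" "y \<in> vertices" if "R x y" for x y using that by (auto simp: R_def)
  have same: "x \<in> K \<longleftrightarrow> y \<in> K" if "K \<in> F" "R x y" "x \<notin> W" "y \<notin> W" for K x y
    using odd_family_same_member[OF WF(1) symp_R that(1,2)] RV[OF that(2)] that(3,4) by blast
  have finF: "finite F" using FK by (intro finite_subset[of F "Pow vertices"]) auto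
  have KW: "x \<notin> W" if "K \<in> F" "x \<in> K" for K x using FK that by blast
  define hit where "hit A = {K\<in>F. K \<inter> A \<noteq> {}}" for A
  define uniform where "uniform A \<longleftrightarrow> (\<forall>x\<in>A - W. \<forall>y\<in>A - W. \<forall>K\<in>F. x \<in> K \<longleftrightarrow> y \<in> K)" for A
  have fin_hit: "finite (hit A)" for A using finF by (simp add: hit_def)
  have hit_uniform: "card (hit A) \<le> 1" if "uniform A" for A
  proof -
    have "K = L" if KL: "K \<in> hit A" "L \<in> hit A" for K L
    proof -
      obtain x y where "x \<in> K" "x \<in> A" "y \<in> L" "y \<in> A" using KL by (auto simp: hit_def)
      moreover have "K \<in> F" "L \<in> F" using KL by (auto simp: hit_def)
      ultimately have "x \<in> L" using \<open>uniform A\<close> KW unfolding uniform_def by blast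
      then show ?thesis using dis \<open>x \<in> K\<close> \<open>K \<in> F\<close> \<open>L \<in> F\<close> by (auto simp: disjoint_def)
    qed
    then show ?thesis using fin_hit by (simp add: card_le_Suc0_iff_eq)
  qed
  have hit_inside: "hit A = {}" if "A \<subseteq> W" for A using that KW by (auto simp: hit_def)
  have two_sets: False if "x \<in> W" "\<And>y. R x y \<Longrightarrow> y \<in> A \<union> B" "card (hit A) \<le> 1" "card (hit B) \<le> 1" for x A B
  proof -
    have "{K\<in>F. \<exists>y\<in>K. R x y} \<subseteq> hit A \<union> hit B" using that(2) by (auto simp: hit_def)
    then have "card {K\<in>F. \<exists>y\<in>K. R x y} \<le> card (hit A \<union> hit B)" using fin_hit by (intro card_mono) auto
    also have "\<dots> \<le> card (hit A) + card (hit B)" by (rule card_Un_le)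
    finally show False using three[OF that(1)] that(3,4) by linarith
  qed
  have uniform_hub: "uniform hub"
    unfolding uniform_def
  proof (intro ballI)
    fix x y K assume "x \<in> hub - W" "y \<in> hub - W" "K \<in> F"
    then show "x \<in> K \<longleftrightarrow> y \<in> K" using R_hub[of x y] same[of K x y] by (cases "x = y") auto
  qed
  have uniform_inner: "uniform (inner v)" if "x \<in> outer v" "x \<notin> W" for x v
    unfolding uniform_def
  proof (intro ballI)
    fix y z K assume "y \<in> inner v - W" "z \<in> inner v - W" "K \<in> F"
    then show "y \<in> K \<longleftrightarrow> z \<in> K"
      using same[of K x y] same[of K x z] R_outer_inner[OF that(1)] that(2) by auto
  qed
  have uniform_outer: "uniform (outer v)" if "x \<in> inner v" "x \<notin> W" for x v
    unfolding uniform_def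
  proof (intro ballI)
    fix y z K assume "y \<in> outer v - W" "z \<in> outer v - W" "K \<in> F"
    then show "y \<in> K \<longleftrightarrow> z \<in> K"
      using same[of K y x] same[of K z x] R_outer_inner[OF _ that(1)] that(2) by auto
  qed
  have uniform_sing: "uniform {x}" for x by (simp add: uniform_def)
  have outer_W: "outer v \<subseteq> W \<and> inner v \<inter> W = {}" if x: "x \<in> outer v" "x \<in> W" for v x
  proof -
    have sub: "outer v \<subseteq> W"
    proof (rule ccontr)
      assume "\<not> outer v \<subseteq> W"
      then obtain z where "z \<in> outer v" "z \<notin> W" by blast
      then have u: "uniform (inner v)" by (rule uniform_inner)
      obtain p where "\<And>y. R x y \<Longrightarrow> y \<in> inner v \<union> {p}"
        using R_outerD[OF x(1)] by (cases x) auto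
      from two_sets[OF x(2) this hit_uniform[OF u] hit_uniform[OF uniform_sing]]
      show False .
    qed
    moreover have False if y: "y \<in> inner v" "y \<in> W" for y
    proof -
      have "card (hit (outer v)) \<le> 1" using hit_inside[OF sub] by simp
      from two_sets[OF y(2) R_innerD[OF y(1)] this hit_uniform[OF uniform_hub]] show False .
    qed
    ultimately show ?thesis by blast
  qed
  have inner_W: "inner v \<subseteq> W" if y: "y \<in> inner v" "y \<in> W" for v y
  proof (rule ccontr)
    assume "\<not> inner v \<subseteq> W"
    then obtain z where "z \<in> inner v" "z \<notin> W" by blast
    then have "uniform (outer v)" by (rule uniform_outer)
    from two_sets[OF y(2) R_innerD[OF y(1)] hit_uniform[OF this] hit_uniform[OF uniform_hub]]
    show False .
  qed
  have extra_W: "extra \<inter> W = {}"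
  proof -
    have False if x: "x \<in> extra" "x \<in> W" for x
      using two_sets[OF x(2), of hub hub] R_extraD[OF x(1)] hit_uniform[OF uniform_hub] by auto
    then show ?thesis by blast
  qed
  define S where "S = {v. outer v \<inter> W \<noteq> {}}"
  \<comment> \<open>For \<open>a = b\<close> an isolated vertex has an empty inner set and falls
    into \<open>T\<close> unless it is in \<open>S\<close>. All vertices outside \<open>S\<close>
    and \<open>T\<close> thus have inner vertices, through which their gadgets are
    connected.\<close>
  define T where "T = {v. v \<notin> S \<and> inner v \<subseteq> W}"
  have S: "outer v \<subseteq> W" "inner v \<inter> W = {}" if "v \<in> S" for v
    using that outer_W unfolding S_def by blast+
  have T: "outer v \<inter> W = {}" "inner v \<subseteq> W" if "v \<in> T" for v
    using that unfolding T_def S_def by blast+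
  have U: "outer v \<inter> W = {}" "inner v \<inter> W = {}" "inner v \<noteq> {}" if "v \<notin> S" "v \<notin> T" for v
    using that inner_W unfolding T_def S_def by blast+
  have ST: "S \<inter> T = {}" by (auto simp: T_def)
  have cardW: "card W = (\<Sum>v\<in>S. card (nb v) + b) + (\<Sum>v\<in>T. card (nb v) + (b - a))"
  proof -
    have "W = (\<Union>v\<in>S. outer v) \<union> (\<Union>v\<in>T. inner v)"
    proof
      show "W \<subseteq> (\<Union>v\<in>S. outer v) \<union> (\<Union>v\<in>T. inner v)"
      proof
        fix x assume x: "x \<in> W"
        then obtain v where v: "x \<in> outer v \<or> x \<in> inner v" using WV extra_W by (auto simp: vertices_def)
        then show "x \<in> (\<Union>v\<in>S. outer v) \<union> (\<Union>v\<in>T. inner v)"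
          using S[of v] T[of v] U[of v] x by blast
      qed
      show "(\<Union>v\<in>S. outer v) \<union> (\<Union>v\<in>T. inner v) \<subseteq> W" using S(1) T(2) by blast
    qed
    moreover have "(\<Union>v\<in>S. outer v) \<inter> (\<Union>v\<in>T. inner v) = {}" using outer_inner_disjoint by blast
    ultimately have "card W = card (\<Union>v\<in>S. outer v) + card (\<Union>v\<in>T. inner v)"
      by (simp add: card_Un_disjoint)
    also have "card (\<Union>v\<in>S. outer v) = (\<Sum>v\<in>S. card (nb v) + b)"
      using outer_disjoint by (subst card_UN_disjoint) (auto simp: card_outer)
    also have "card (\<Union>v\<in>T. inner v) = (\<Sum>v\<in>T. card (nb v) + (b - a))"
      using inner_disjoint by (subst card_UN_disjoint) (auto simp: card_inner)
    finally show ?thesis .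
  qed
  \<comment> \<open>These three sets collect vertices that are isolated outside \<open>W\<close>:
    hard vertices over \<open>S\<close>, half edges from \<open>T\<close> to \<open>S\<close>, and
    dummies over \<open>T\<close>. Each accounts for at most one member.\<close>
  define P1 where "P1 = (\<Union>v\<in>S. hard v)"
  define P2 where "P2 = (\<Union>v\<in>T. Half v ` {u. g v u \<and> u \<in> S})"
  define P3 where "P3 = (\<Union>v\<in>T. Dummy v ` {..<b})"
  define P where "P = P1 \<union> P2 \<union> P3"
  have finP: "finite P" by (simp add: P_def P1_def P2_def P3_def)
  have "card P \<le> card P1 + card P2 + card P3"
    unfolding P_def by (meson add_right_mono card_Un_le le_trans)
  also have "card P1 = (\<Sum>v\<in>S. card (nb v))"
    unfolding P1_def using inner_disjoint by (subst card_UN_disjoint) (auto simp: card_hard inner_def)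
  also have "card P2 = (\<Sum>v\<in>T. card {u. g v u \<and> u \<in> S})"
    unfolding P2_def by (subst card_UN_disjoint) (auto simp: card_image inj_on_def)
  also have "card P3 = b * card T"
    unfolding P3_def by (subst card_UN_disjoint) (auto simp: card_image inj_on_def)
  finally have cardP: "card P \<le> (\<Sum>v\<in>S. card (nb v)) + (\<Sum>v\<in>T. card {u. g v u \<and> u \<in> S}) + b * card T" .
  \<comment> \<open>Besides the members met by isolated vertices at most one contains hub vertices.
    What remains descends to the graph.\<close>
  define F3 where "F3 = F - hit P - hit hub"
  have hub_card: "card (hit hub) \<le> (if a < b then 1 else 0)"
  proof (cases "a < b")
    case False
    then have "hub = {}" by (auto simp: hub_def set_defs)
    then show ?thesis using False by (simp add: hit_def)
  qed (use hit_uniform[OF uniform_hub] in simp)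
  have "card F \<le> card (hit P) + card (hit hub) + card F3"
  proof -
    have "F = hit P \<union> hit hub \<union> F3" by (auto simp: F3_def hit_def)
    then have "card F \<le> card (hit P \<union> hit hub) + card F3" by (metis card_Un_le)
    then show ?thesis using card_Un_le[of "hit P" "hit hub"] by linarith
  qed
  moreover have "card (hit P) \<le> card P"
    using card_hit_le[OF dis finP] by (simp add: hit_def)
  ultimately have cardF: "card F \<le> (\<Sum>v\<in>S. card (nb v)) + (\<Sum>v\<in>T. card {u. g v u \<and> u \<in> S}) + b * card T
      + (if a < b then 1 else 0) + card F3"
    using cardP hub_card by linarith
  define proj where "proj K = {v. v \<notin> S \<and> v \<notin> T \<and> (outer v \<union> inner v) \<inter> K \<noteq> {}}" for K
  have proj_whole: "outer v \<union> inner v \<subseteq> K" if K: "K \<in> F" "v \<in> proj K" for K v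
  proof -
    have v: "outer v \<inter> W = {}" "inner v \<inter> W = {}" "inner v \<noteq> {}" "(outer v \<union> inner v) \<inter> K \<noteq> {}"
      using U[of v] K(2) by (auto simp: proj_def)
    have "x \<in> K \<longleftrightarrow> y \<in> K" if "x \<in> outer v" "y \<in> inner v" for x y
      using same[OF K(1) R_outer_inner[OF that]] that v(1,2) by blast
    moreover have "Dummy v 0 \<in> outer v" using b_pos by (auto simp: outer_def)
    ultimately show ?thesis using v(3,4) by blast
  qed
  have F3_D: "K \<in> F" "K \<inter> P = {}" "K \<inter> hub = {}" if "K \<in> F3" for K
    using that by (auto simp: F3_def hit_def)
  have F3_split: "K = (\<Union>v\<in>proj K. outer v \<union> inner v) \<union> (\<Union>u\<in>proj K. (\<lambda>v. Half v u) ` {v\<in>T. g u v})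
      \<union> {x\<in>K. \<exists>v\<in>T. \<exists>u\<in>T. g v u \<and> x = Half v u}" (is "K = ?K1 \<union> ?K2 \<union> ?K3") if K: "K \<in> F3" for K
  proof
    show "K \<subseteq> ?K1 \<union> ?K2 \<union> ?K3"
    proof
      fix x assume x: "x \<in> K"
      have xW: "x \<notin> W" "x \<in> vertices" using FK F3_D(1)[OF K] x by blast+
      have xP: "x \<notin> P" "x \<notin> hub" using F3_D[OF K] x by blast+
      then have "x \<notin> extra" by (auto simp: hub_def)
      then obtain v where v: "x \<in> outer v \<or> x \<in> inner v" using xW by (auto simp: vertices_def)
      consider "v \<in> S" | "v \<in> T" | "v \<notin> S" "v \<notin> T" by blast
      then show "x \<in> ?K1 \<union> ?K2 \<union> ?K3"
      proof cases
        case 1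
        then have "x \<in> hard v \<or> x \<in> opts v" using S(1) v xW(1) by (auto simp: inner_def)
        then show ?thesis using xP 1 by (auto simp: P_def P1_def hub_def)
      next
        case 2
        then have "x \<in> outer v" using T(2) v xW(1) by auto
        moreover have "x \<notin> Dummy v ` {..<b}" using xP(1) 2 by (auto simp: P_def P3_def)
        ultimately obtain u where u: "g v u" "x = Half v u" by (auto simp: outer_def nb_def)
        have "u \<notin> S" using xP(1) 2 u by (auto simp: P_def P2_def)
        show ?thesis
        proof (cases "u \<in> T")
          case True
          then show ?thesis using 2 u x by blast
        next
          case False
          have *: "Half u v \<in> outer u" using g_sym[OF u(1)] by (auto simp: outer_def nb_def)
          then have "Half u v \<in> K"
            using same[OF F3_D(1)[OF K] R_Half[OF u(1)]] xW(1) x u(2) U(1)[OF \<open>u \<notin> S\<close> False] by blast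
          then have "u \<in> proj K" using * \<open>u \<notin> S\<close> False by (auto simp: proj_def)
          then show ?thesis using u 2 g_sym by blast
        qed
      next
        case 3
        then have "v \<in> proj K" using v x by (auto simp: proj_def)
        then show ?thesis using v by blast
      qed
    qed
    have "?K2 \<subseteq> K"
    proof
      fix x assume "x \<in> ?K2"
      then obtain u v where uv: "u \<in> proj K" "v \<in> T" "g u v" "x = Half v u" by blast
      have "Half u v \<in> outer u" "Half v u \<in> outer v" using uv(3) g_sym by (auto simp: outer_def nb_def)
      then have "Half u v \<in> K" "Half u v \<notin> W" "Half v u \<notin> W"
        using proj_whole[OF F3_D(1)[OF K] uv(1)] T(1)[OF uv(2)] KW[OF F3_D(1)[OF K]] by blast+
      then show "x \<in> K" using same[OF F3_D(1)[OF K] R_Half[OF uv(3)]] uv(4) by blast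
    qed
    then show "?K1 \<union> ?K2 \<union> ?K3 \<subseteq> K" using proj_whole[OF F3_D(1)[OF K]] by blast
  qed
  have F3_parity: "odd ((\<Sum>v\<in>proj K. 2 * card (nb v) + b + (b - a)) + touching (proj K) T)" if K: "K \<in> F3" for K
  proof -
    let ?K1 = "\<Union>v\<in>proj K. outer v \<union> inner v" and ?K2 = "\<Union>u\<in>proj K. (\<lambda>v. Half v u) ` {v\<in>T. g u v}"
      and ?K3 = "{x\<in>K. \<exists>v\<in>T. \<exists>u\<in>T. g v u \<and> x = Half v u}"
    have finK: "finite K" using FK[OF F3_D(1)[OF K]] by (rule finite_subset) auto
    have projT: "proj K \<inter> T = {}" by (auto simp: proj_def)
    have swap: "Half u v \<in> K" if "Half v u \<in> K" "v \<in> T" "u \<in> T" "g v u" for u v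
    proof -
      have "Half u v \<in> outer u" using g_sym[OF that(4)] by (auto simp: outer_def nb_def)
      then have "Half u v \<notin> W" using T(1)[OF that(3)] by blast
      then show ?thesis
        using same[OF F3_D(1)[OF K] R_Half[OF that(4)]] that(1) KW[OF F3_D(1)[OF K] that(1)] by blast
    qed
    \<comment> \<open>Half edges inside \<open>T\<close> come in opposite pairs. The parity of
      \<open>K\<close> is therefore decided by its whole gadgets and its half edges from
      \<open>T\<close> to them; in particular a member of \<open>F3\<close> contains a whole
      gadget.\<close>
    have "even (card ?K3)"
    proof (rule even_card_involution)
      show "(case x of Half v u \<Rightarrow> Half u v | _ \<Rightarrow> x) \<in> ?K3 \<and>
          (case (case x of Half v u \<Rightarrow> Half u v | _ \<Rightarrow> x) of Half v u \<Rightarrow> Half u v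
            | _ \<Rightarrow> (case x of Half v u \<Rightarrow> Half u v | _ \<Rightarrow> x)) = x \<and>
          (case x of Half v u \<Rightarrow> Half u v | _ \<Rightarrow> x) \<noteq> x" if x: "x \<in> ?K3" for x
      proof -
        obtain v u where "x = Half v u" "v \<in> T" "u \<in> T" "g v u" "x \<in> K" using x by blast
        moreover from this have "v \<noteq> u" using g_irrefl by auto
        ultimately show ?thesis using swap[of v u] g_sym by auto
      qed
    qed (use finK in auto)
    moreover have "card ?K2 = touching (proj K) T"
      unfolding touching_def by (subst card_UN_disjoint) (auto simp: card_image inj_on_def)
    moreover have "card K = card ?K1 + card ?K2 + card ?K3"
    proof -
      have "?K1 \<inter> ?K2 = {}" "?K1 \<inter> ?K3 = {}" "?K2 \<inter> ?K3 = {}"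
        using projT by (auto simp: set_defs)
      then have "card (?K1 \<union> ?K2 \<union> ?K3) = card ?K1 + card ?K2 + card ?K3"
        using finK by (intro card_Un3) auto
      then show ?thesis using F3_split[OF K] by simp
    qed
    ultimately show ?thesis using oddK[OF F3_D(1)[OF K]] by (simp add: card_gadget_Union)
  qed
  have F3_ne: "proj K \<noteq> {}" if "K \<in> F3" for K
    using F3_parity[OF that] by (auto simp: touching_def)
  define C where "C = proj ` F3"
  have proj_eq: "K = L" if KL: "K \<in> F3" "L \<in> F3" "v \<in> proj K" "v \<in> proj L" for K L v
  proof -
    have "Dummy v 0 \<in> outer v" using b_pos by (auto simp: outer_def)
    then have "Dummy v 0 \<in> K" "Dummy v 0 \<in> L" using proj_whole F3_D(1) KL by blast+
    then show ?thesis using dis F3_D(1) KL by (auto simp: disjoint_def)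
  qed
  have "inj_on proj F3" using proj_eq F3_ne unfolding inj_on_def by blast
  then have cardC: "card C = card F3" by (simp add: C_def card_image)
  have "factor_barrier S T C"
    unfolding factor_barrier_def
  proof (intro conjI ballI impI allI)
    show "disjoint C" using proj_eq unfolding C_def disjoint_def by blast
    \<comment> \<open>A whole gadget then contains an optional vertex, which belongs to the hub, and
      \<open>F3\<close> avoids the hub.\<close>
    show "C = {}" if "a < b"
    proof -
      have False if K: "K \<in> F3" for K
      proof -
        obtain v where v: "v \<in> proj K" using F3_ne[OF K] by blast
        have "Opt v 0 \<in> opts v" using \<open>a < b\<close> by (auto simp: opts_def)
        then have "Opt v 0 \<in> inner v" "Opt v 0 \<in> hub" unfolding inner_def hub_def by blast+
        then show False using proj_whole[OF F3_D(1)[OF K] v] F3_D(3)[OF K] by blast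
      qed
      then show ?thesis by (auto simp: C_def)
    qed
    then have ab: "a = b" if "C \<noteq> {}" using that a_le_b by linarith
    fix D assume D: "D \<in> C"
    then obtain K where K: "K \<in> F3" "D = proj K" by (auto simp: C_def)
    show "D \<inter> (S \<union> T) = {}" using K by (auto simp: proj_def)
    have "a = b" using ab D by auto
    then have "(\<Sum>v\<in>D. 2 * card (nb v) + b + (b - a)) = 2 * (\<Sum>v\<in>D. card (nb v)) + b * card D"
      by (simp add: sum.distrib sum_distrib_left)
    then show "odd (b * card D + touching D T)" using F3_parity[OF K(1)] K(2) by simp
    fix u v assume uv: "u \<in> D" "g u v"
    show "v \<in> D \<union> S \<union> T"
    proof (rule ccontr)
      assume v: "v \<notin> D \<union> S \<union> T"
      have o: "Half u v \<in> outer u" "Half v u \<in> outer v" using uv(2) g_sym by (auto simp: outer_def nb_def)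
      then have "Half u v \<in> K" using proj_whole[OF F3_D(1)[OF K(1)]] uv(1) K(2) by blast
      moreover have "Half v u \<notin> W" using U(1)[of v] v o by blast
      ultimately have "Half v u \<in> K"
        using same[OF F3_D(1)[OF K(1)] R_Half[OF uv(2)]] KW[OF F3_D(1)[OF K(1)]] by blast
      then show False using v o K(2) by (auto simp: proj_def)
    qed
  next
    have deg: "card (nb v) = out_degree S v + card {u. g v u \<and> u \<in> S}" for v
    proof -
      have "nb v = {u. g v u \<and> u \<notin> S} \<union> {u. g v u \<and> u \<in> S}" by (auto simp: nb_def)
      then show ?thesis unfolding out_degree_def by (simp add: card_Un_disjoint disjoint_iff)
    qed
    have "(\<Sum>v\<in>T. card (nb v)) = (\<Sum>v\<in>T. out_degree S v) + (\<Sum>v\<in>T. card {u. g v u \<and> u \<in> S})"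
      by (simp add: deg sum.distrib)
    moreover have "card W = (\<Sum>v\<in>S. card (nb v)) + b * card S + (\<Sum>v\<in>T. card (nb v)) + (b - a) * card T"
      by (simp add: cardW sum.distrib mult.commute)
    moreover have "(b - a) * card T + a * card T = b * card T"
      using a_le_b by (simp flip: add_mult_distrib)
    \<comment> \<open>The degrees over \<open>S\<close> cancel, and over \<open>T\<close> only the
      edges leaving \<open>S\<close> aside survive. Of the excess 2 one unit pays for the hub
      member, which exists only if \<open>a < b\<close>.\<close>
    ultimately show "b * card S + (\<Sum>v\<in>T. out_degree S v) + (if a < b then 1 else 2) \<le> a * card T + card C"
      using WF(2) cardF cardC by (auto split: if_splits)
  qed (rule ST)
  then show ?thesis by blast
qed

end

subsection \<open>Toughness excludes barriers\<close>

text \<open>A vertex with least \<open>d\<close> is chosen and removed with its neighbours, each of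
  which has a truncated difference \<open>a - d u\<close> no larger than that of the chosen vertex.
  The result is also a maximal independent set, which is all that its second use requires.\<close>

lemma greedy_independent_set:
  fixes g :: "'a \<Rightarrow> 'a \<Rightarrow> bool" and d :: "'a \<Rightarrow> nat"
  assumes sym: "\<And>u v. g u v \<Longrightarrow> g v u" and irr: "\<And>v. \<not> g v v"
  shows "finite V \<Longrightarrow> \<exists>I\<subseteq>V. (\<forall>u\<in>I. \<forall>v\<in>I. \<not> g u v) \<and> (\<forall>v\<in>V. v \<in> I \<or> (\<exists>u\<in>I. g u v)) \<and>
    (\<Sum>v\<in>V. a - d v) \<le> (\<Sum>v\<in>I. (card {u\<in>V. g v u} + 1) * (a - d v))"
proof (induction "card V" arbitrary: V rule: less_induct)
  case less
  note fin = less.prems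
  show ?case
  proof (cases "V = {}")
    case False
    then obtain v where v: "v \<in> V" "\<And>u. u \<in> V \<Longrightarrow> d v \<le> d u"
      using fin by (metis arg_min_if_finite(1) arg_min_least)
    define N where "N = {u\<in>V. g v u}"
    define V' where "V' = V - insert v N"
    have "card V' < card V" unfolding V'_def using fin v(1) by (intro psubset_card_mono) auto
    moreover have fin': "finite V'" using fin by (simp add: V'_def)
    ultimately obtain I where I: "I \<subseteq> V'" "\<forall>u\<in>I. \<forall>v\<in>I. \<not> g u v" "\<forall>v\<in>V'. v \<in> I \<or> (\<exists>u\<in>I. g u v)"
      "(\<Sum>v\<in>V'. a - d v) \<le> (\<Sum>v\<in>I. (card {u\<in>V'. g v u} + 1) * (a - d v))"
      using less.hyps[of V'] by blast
    have vI: "v \<notin> I" "finite I" using I(1) fin' finite_subset by (auto simp: V'_def)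
    have vN: "v \<notin> N" "N \<subseteq> V" "finite N" using irr fin by (auto simp: N_def)
    have "V = insert v N \<union> V'" using v(1) vN by (auto simp: V'_def)
    then have "(\<Sum>v\<in>V. a - d v) = (\<Sum>v\<in>insert v N \<union> V'. a - d v)" by simp
    also have "\<dots> = (\<Sum>v\<in>insert v N. a - d v) + (\<Sum>v\<in>V'. a - d v)"
      using vN fin' by (intro sum.union_disjoint) (auto simp: V'_def)
    also have "(\<Sum>v\<in>insert v N. a - d v) \<le> of_nat (card (insert v N)) * (a - d v)"
      using v vN by (intro sum_bounded_above diff_le_mono2) auto
    also have "(\<Sum>v\<in>V'. a - d v) \<le> (\<Sum>v\<in>I. (card {u\<in>V. g v u} + 1) * (a - d v))"
      using fin by (intro order_trans[OF I(4)] sum_mono mult_right_mono add_right_mono card_mono)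
        (auto simp: V'_def)
    finally have "(\<Sum>v\<in>V. a - d v) \<le> (\<Sum>v\<in>insert v I. (card {u\<in>V. g v u} + 1) * (a - d v))"
      using vI vN by (simp add: N_def)
    moreover have "\<forall>u\<in>insert v I. \<forall>w\<in>insert v I. \<not> g u w"
      using I(1,2) irr sym by (auto simp: V'_def N_def)
    moreover have "\<forall>u\<in>V. u \<in> insert v I \<or> (\<exists>w\<in>insert v I. g w u)"
      using I(3) by (auto simp: V'_def N_def)
    moreover have "insert v I \<subseteq> V" using I(1) v(1) by (auto simp: V'_def)
    ultimately show ?thesis by blast
  qed simp
qed

context factor_gadget
begin

text \<open>A vertex \<open>u\<close> of a member with more than \<open>b\<close> neighbours in \<open>T\<close> may be moved to \<open>S\<close>; and the
  parity condition excludes that all vertices of a member have exactly \<open>b\<close> neighbours in \<open>T\<close>.\<close>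

lemma barrier_with_sparse_vertices:
  assumes "factor_barrier S0 T0 C0"
  obtains S T C where "factor_barrier S T C" "\<And>K. K \<in> C \<Longrightarrow> \<exists>u\<in>K. card {v\<in>T. g u v} < b"
proof -
  \<comment> \<open>With \<open>S\<close> of maximal size no vertex can be moved into it. Moving
    \<open>u\<close> costs \<open>b\<close> for \<open>S\<close> and one member of \<open>C\<close>,
    and is paid for by the more than \<open>b\<close> neighbours of \<open>u\<close> in
    \<open>T\<close>, whose degrees outside \<open>S\<close> drop.\<close>
  define P where "P = {card S | S T C. factor_barrier S T C}"
  have "P \<subseteq> {..CARD('v)}" by (auto simp: P_def intro: card_mono)
  then have finP: "finite P" using finite_subset by blast
  have "card S0 \<in> P" using assms by (auto simp: P_def)
  then have "Max P \<in> P" using finP by (intro Max_in) auto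
  then obtain S T C where bar: "factor_barrier S T C" and "card S = Max P" by (auto simp: P_def)
  then have max: "card S' \<le> card S" if "factor_barrier S' T' C'" for S' T' C'
  proof -
    have "card S' \<in> P" using that by (auto simp: P_def)
    then show ?thesis using \<open>card S = Max P\<close> finP by simp
  qed
  note bar' = bar[unfolded factor_barrier_def]
  have "\<exists>u\<in>K. card {v\<in>T. g u v} < b" if K: "K \<in> C" for K
  proof (rule ccontr)
    assume "\<not> (\<exists>u\<in>K. card {v\<in>T. g u v} < b)"
    then have ge: "b \<le> card {v\<in>T. g u v}" if "u \<in> K" for u using that by auto
    have KST: "K \<inter> (S \<union> T) = {}" and oddK: "odd (b * card K + touching K T)" and ab: "\<not> a < b"
      using bar' K by auto
    show False
    proof (cases "\<exists>u\<in>K. b < card {v\<in>T. g u v}")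
      case False
      then have "card {v\<in>T. g u v} = b" if "u \<in> K" for u using ge[OF that] that by (meson le_antisym not_less)
      then have "touching K T = b * card K" by (simp add: touching_def)
      then show False using oddK by simp
    next
      case True
      then obtain u where u: "u \<in> K" "b < card {v\<in>T. g u v}" by blast
      have uST: "u \<notin> S" "u \<notin> T" using KST u(1) by auto
      have uK: "u \<notin> K'" if "K' \<in> C - {K}" for K'
        using bar' K u(1) that by (auto simp: disjoint_def)
      have "factor_barrier (insert u S) T (C - {K})"
        unfolding factor_barrier_def
      proof (intro conjI ballI)
        show "insert u S \<inter> T = {}" using bar' uST by auto
        show "disjoint (C - {K})" using bar' by (auto simp: disjoint_def)
        show "a < b \<longrightarrow> C - {K} = {}" using ab by simp
        fix K' assume K': "K' \<in> C - {K}"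
        then have "K' \<inter> (S \<union> T) = {} \<and> odd (b * card K' + touching K' T) \<and>
          (\<forall>u\<in>K'. \<forall>v. g u v \<longrightarrow> v \<in> K' \<union> S \<union> T)" using bar' by auto
        then show "K' \<inter> (insert u S \<union> T) = {}" "odd (b * card K' + touching K' T)"
          "\<And>w. w \<in> K' \<Longrightarrow> \<forall>v. g w v \<longrightarrow> v \<in> K' \<union> insert u S \<union> T" using uK[OF K'] by auto
      next
        have "out_degree S v = out_degree (insert u S) v + (if g u v then 1 else 0)" for v
        proof -
          have eq: "{w. g v w \<and> w \<notin> S} = {w. g v w \<and> w \<notin> insert u S} \<union> (if g u v then {u} else {})"
            using uST g_sym[of u v] g_sym[of v u] by auto
          have "card {w. g v w \<and> w \<notin> S} = card {w. g v w \<and> w \<notin> insert u S} + card (if g u v then {u} else {})"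
            unfolding eq by (subst card_Un_disjoint) auto
          then show ?thesis by (simp add: out_degree_def)
        qed
        then have "(\<Sum>v\<in>T. out_degree S v) = (\<Sum>v\<in>T. out_degree (insert u S) v) + card {v\<in>T. g u v}"
          by (simp add: sum.distrib sum.If_cases Int_def)
        moreover have "card C = card (C - {K}) + 1" using card_Suc_Diff1[of C K] K by simp
        moreover have "card (insert u S) = card S + 1" using uST by simp
        ultimately show "b * card (insert u S) + (\<Sum>v\<in>T. out_degree (insert u S) v) + (if a < b then 1 else 2)
          \<le> a * card T + card (C - {K})"
          using bar' u(2) by (simp add: algebra_simps)
      qed
      from max[OF this] show False using uST by simp
    qed
  qed
  with bar show ?thesis using that by blast
qed

text \<open>\<open>tough\<close> is toughness \<open>a - 1 + a / b\<close> with the denominator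
  cleared. For \<open>a < b\<close>, where \<open>C\<close> is empty, vertices of \<open>T\<close>
  with degree below \<open>a\<close> outside \<open>S\<close> suffice; for \<open>a = b\<close> a
  second separator must also cut off a part of many members of \<open>C\<close>.\<close>

theorem tough_no_barrier:
  assumes a_pos: "0 < a" and deg: "\<And>v. a \<le> card (nb v)"
    and tough: "\<And>X F. closed_family g X F \<Longrightarrow> 2 \<le> card F \<Longrightarrow> (b * (a - 1) + a) * card F \<le> b * card X"
  shows "\<not> factor_barrier S0 T0 C0"
proof
  assume "factor_barrier S0 T0 C0"
  then obtain S T C where bar: "factor_barrier S T C"
    and "\<And>K. K \<in> C \<Longrightarrow> \<exists>u\<in>K. card {v\<in>T. g u v} < b"
    using barrier_with_sparse_vertices by metis
  then obtain r where r: "\<And>K. K \<in> C \<Longrightarrow> r K \<in> K" "\<And>K. K \<in> C \<Longrightarrow> card {v\<in>T. g (r K) v} < b"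
    by metis
  have ST: "S \<inter> T = {}" and disC: "disjoint C" and Cab: "a < b \<Longrightarrow> C = {}"
    and CST: "\<And>K. K \<in> C \<Longrightarrow> K \<inter> (S \<union> T) = {}"
    and Ccl: "\<And>K u v. K \<in> C \<Longrightarrow> u \<in> K \<Longrightarrow> g u v \<Longrightarrow> v \<in> K \<union> S \<union> T"
    and ineq: "b * card S + (\<Sum>v\<in>T. out_degree S v) + (if a < b then 1 else 2) \<le> a * card T + card C"
    using bar unfolding factor_barrier_def by auto
  define d where "d = out_degree S"
  define N where "N v = {u. g v u \<and> u \<notin> S}" for v
  have dN: "card (N v) = d v" for v by (simp add: N_def d_def out_degree_def)
  define TL where "TL = {v\<in>T. d v < a}"
  define TE where "TE = {v\<in>T. d v = a}"
  define TG where "TG = {v\<in>T. a < d v}"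
  \<comment> \<open>For \<open>d v < a\<close> this makes \<open>w v + b * d v\<close> equal to the
    toughness constant \<open>b * (a - 1) + a\<close>: isolating \<open>v\<close> adds at most
    \<open>d v\<close> vertices to the separator, and \<open>w v\<close> is the share left to
    \<open>S\<close>.\<close>
  define w where "w v = b * (a - 1 - d v) + a" for v
  obtain I where I: "I \<subseteq> TL" "\<forall>u\<in>I. \<forall>v\<in>I. \<not> g u v" "\<forall>v\<in>TL. v \<in> I \<or> (\<exists>u\<in>I. g u v)"
    "(\<Sum>v\<in>TL. a - d v) \<le> (\<Sum>v\<in>I. (card {u\<in>TL. g v u} + 1) * (a - d v))"
    using greedy_independent_set[of g TL a d] g_sym g_irrefl by auto
  have IT: "v \<in> T" "v \<notin> S" "d v < a" if "v \<in> I" for v using that I(1) ST by (auto simp: TL_def)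
  have sing_inj: "card ((\<lambda>v. {v}) ` A) = card A" for A :: "'v set" by (simp add: card_image)
  have weights: "(\<Sum>v\<in>I. w v) \<le> b * card S"
  proof -
    consider "card I = 0" | "card I = 1" | "2 \<le> card I" by linarith
    then show ?thesis
    proof cases
      case 2
      then obtain v where v: "I = {v}" by (auto simp: card_1_singleton_iff)
      have "nb v \<subseteq> N v \<union> S" by (auto simp: nb_def N_def)
      then have "card (nb v) \<le> card (N v \<union> S)" by (intro card_mono) auto
      also have "\<dots> \<le> d v + card S" using card_Un_le[of "N v" S] by (simp add: dN)
      finally have "a - d v \<le> card S" using deg[of v] by linarith
      then have "b * (a - d v) \<le> b * card S" by simp
      moreover have "a - d v = Suc (a - 1 - d v)" using IT(3)[of v] v by simp
      ultimately show ?thesis using a_le_b v by (simp add: w_def)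
    next
      case 3
      define X where "X = S \<union> (\<Union>v\<in>I. N v)"
      have "closed_family g X ((\<lambda>v. {v}) ` I)"
        using IT I(2) by (auto simp: closed_family_def X_def N_def disjoint_def)
      from tough[OF this] have "(b * (a - 1) + a) * card I \<le> b * card X"
        using 3 by (simp add: sing_inj)
      also have "card X \<le> card S + card (\<Union>v\<in>I. N v)" unfolding X_def by (rule card_Un_le)
      also have "card (\<Union>v\<in>I. N v) \<le> (\<Sum>v\<in>I. d v)"
        using card_UN_le[of I N] by (simp add: dN)
      finally have "(b * (a - 1) + a) * card I \<le> b * card S + b * (\<Sum>v\<in>I. d v)"
        by (simp add: add_mult_distrib2)
      moreover have "(b * (a - 1) + a) * card I = (\<Sum>v\<in>I. w v + b * d v)"
      proof -
        have "w v + b * d v = b * (a - 1) + a" if "v \<in> I" for v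
        proof -
          have "a - 1 = (a - 1 - d v) + d v" using IT(3)[OF that] by simp
          then have "b * (a - 1) = b * (a - 1 - d v) + b * d v" by (metis add_mult_distrib2)
          then show ?thesis by (simp add: w_def)
        qed
        then show ?thesis by simp
      qed
      ultimately show ?thesis by (simp add: sum.distrib sum_distrib_left)
    qed simp
  qed
  \<comment> \<open>A vertex of \<open>I\<close> has fewer than \<open>a\<close> neighbours outside
    \<open>S\<close>, so \<open>c + m + 1 \<le> a\<close> and
    \<open>(c + 1) * e \<le> b * e\<close>. The surplus \<open>card (N v - T)\<close> is kept to pay
    for members of \<open>C\<close> whose representative is adjacent to \<open>I\<close>.\<close>
  have excess: "(\<Sum>v\<in>TL. a - d v) + (\<Sum>v\<in>I. card (N v - T)) \<le> (\<Sum>v\<in>I. w v)"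
  proof -
    have "(card {u\<in>TL. g v u} + 1) * (a - d v) + card (N v - T) \<le> w v" if "v \<in> I" for v
    proof -
      define c where "c = card {u\<in>TL. g v u}"
      define m where "m = card (N v - T)"
      define e where "e = a - 1 - d v"
      have ea: "a - d v = e + 1" "d v + 1 \<le> a" using IT(3)[OF that] by (auto simp: e_def)
      have "c + m = card ({u\<in>TL. g v u} \<union> (N v - T))"
        unfolding c_def m_def by (subst card_Un_disjoint) (auto simp: TL_def)
      also have "\<dots> \<le> card (N v)" using ST by (intro card_mono) (auto simp: N_def TL_def)
      finally have cm: "c + m \<le> d v" by (simp add: dN)
      have "(c + 1) * e \<le> b * e" using cm ea(2) a_le_b by (intro mult_right_mono) auto
      moreover have "w v = b * e + a" by (simp add: w_def e_def)
      ultimately have "(c + 1) * (a - d v) + m \<le> w v" using cm ea by (simp add: algebra_simps)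
      then show ?thesis by (simp add: c_def m_def)
    qed
    then have "(\<Sum>v\<in>I. (card {u\<in>TL. g v u} + 1) * (a - d v) + card (N v - T)) \<le> (\<Sum>v\<in>I. w v)"
      by (rule sum_mono)
    then show ?thesis using I(4) by (simp add: sum.distrib)
  qed
  have main: "b * card S + card TG + (if a < b then 1 else 2) \<le> (\<Sum>v\<in>TL. a - d v) + card C"
  proof -
    have T: "T = TL \<union> TE \<union> TG" by (auto simp: TL_def TE_def TG_def)
    have sumT: "(\<Sum>v\<in>T. f v) = (\<Sum>v\<in>TL. f v) + (\<Sum>v\<in>TE. f v) + (\<Sum>v\<in>TG. f v)" for f :: "'v \<Rightarrow> nat"
      unfolding T by (subst sum.union_disjoint sum.union_disjoint; (simp | auto simp: TL_def TE_def TG_def))+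
    have "a * card T = (\<Sum>v\<in>T. a)" by simp
    also have "\<dots> = (\<Sum>v\<in>TL. d v + (a - d v)) + (\<Sum>v\<in>TE. d v) + (\<Sum>v\<in>TG. a)"
      unfolding sumT by (simp add: TL_def TE_def)
    finally have "a * card T = (\<Sum>v\<in>TL. d v + (a - d v)) + (\<Sum>v\<in>TE. d v) + (\<Sum>v\<in>TG. a)" .
    moreover have "(\<Sum>v\<in>TG. a + 1) \<le> (\<Sum>v\<in>TG. d v)" by (intro sum_mono) (auto simp: TG_def)
    ultimately have "a * card T + card TG \<le> (\<Sum>v\<in>TL. a - d v) + (\<Sum>v\<in>T. d v)"
      unfolding sumT[of d] by (simp add: sum.distrib)
    with ineq show ?thesis by (simp add: d_def)
  qed
  show False
  proof (cases "a < b")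
    case True
    then show False using main excess weights Cab by simp
  next
    case False
    then have ab: "a = b" using a_le_b by simp
    \<comment> \<open>Representatives next to \<open>I\<close> will be swallowed by the separator;
      their members \<open>L\<close> are charged injectively to \<open>NI - T\<close>. Only the
      members in \<open>Q\<close> are to be cut off.\<close>
    define NI where "NI = (\<Union>v\<in>I. N v)"
    define L where "L = {K\<in>C. r K \<in> NI}"
    define Q where "Q = C - L"
    have r_inj: "K = K'" if "K \<in> C" "K' \<in> C" "r K \<in> K'" for K K'
      using r(1)[OF that(1)] that disC by (auto simp: disjoint_def)
    have "card L \<le> card (NI - T)"
    proof (rule card_inj_on_le[of r])
      show "inj_on r L" using r_inj r(1) by (intro inj_onI) (auto simp: L_def)
      show "r ` L \<subseteq> NI - T" using r(1) CST by (auto simp: L_def)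
    qed simp
    also have "NI - T = (\<Union>v\<in>I. N v - T)" by (auto simp: NI_def)
    also have "card \<dots> \<le> (\<Sum>v\<in>I. card (N v - T))" by (rule card_UN_le) simp
    finally have cL: "card L \<le> (\<Sum>v\<in>I. card (N v - T))" .
    have "card C = card L + card Q"
    proof -
      have "C = L \<union> Q" by (auto simp: L_def Q_def)
      then show ?thesis using card_Un_disjoint[of L Q] by (simp add: Q_def)
    qed
    then have main': "b * card S + card TG + 2 \<le> (\<Sum>v\<in>I. w v) + card Q"
      using main excess cL False by simp
    \<comment> \<open>The slack 2 gives \<open>Q\<close> two members, so toughness applies to the
      family below even if \<open>I\<close> and \<open>J\<close> are empty.\<close>
    then have q: "card TG + 2 \<le> card Q" using weights by linarith
    \<comment> \<open>Vertices of degree exactly \<open>a\<close> outside \<open>S\<close> and not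
      next to \<open>I\<close> are split: those adjacent to a representative go into the separator,
      at most \<open>b - 1\<close> for each member of \<open>Q\<close>, and among the others a
      maximal independent set \<open>J\<close> is isolated.\<close>
    define D where "D = {v\<in>TE. v \<notin> NI \<and> (\<exists>K\<in>Q. g (r K) v)}"
    define Rest where "Rest = {v\<in>TE. v \<notin> NI \<and> (\<forall>K\<in>Q. \<not> g (r K) v)}"
    obtain J where J: "J \<subseteq> Rest" "\<forall>u\<in>J. \<forall>v\<in>J. \<not> g u v" "\<forall>v\<in>Rest. v \<in> J \<or> (\<exists>u\<in>J. g u v)"
      using greedy_independent_set[of g Rest a d] g_sym g_irrefl by auto
    have cD: "card D \<le> (b - 1) * card Q"
    proof -
      have "D \<subseteq> (\<Union>K\<in>Q. {v\<in>T. g (r K) v})" by (auto simp: D_def TE_def)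
      then have "card D \<le> card (\<Union>K\<in>Q. {v\<in>T. g (r K) v})" by (intro card_mono) auto
      also have "\<dots> \<le> (\<Sum>K\<in>Q. card {v\<in>T. g (r K) v})" by (rule card_UN_le) simp
      also have "\<dots> \<le> (\<Sum>K\<in>Q. b - 1)"
      proof (rule sum_mono)
        fix K assume "K \<in> Q"
        then show "card {v\<in>T. g (r K) v} \<le> b - 1" using r(2)[of K] by (simp add: Q_def)
      qed
      finally show ?thesis by (simp add: mult.commute)
    qed
    have JT: "v \<in> T" "v \<notin> S" "d v = a" "v \<notin> NI" "\<And>K. K \<in> Q \<Longrightarrow> \<not> g (r K) v" if "v \<in> J" for v
      using that J(1) ST by (auto simp: Rest_def TE_def)
    define M where "M = I \<union> J"
    have MT: "v \<in> T" "v \<notin> S" if "v \<in> M" for v using that IT JT by (auto simp: M_def)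
    have indM: "\<not> g u v" if "u \<in> M" "v \<in> M" for u v
    proof -
      have "\<not> g x y" if "x \<in> I" "y \<in> J" for x y
        using JT(2,4)[OF that(2)] that(1) by (auto simp: NI_def N_def)
      then show ?thesis using that I(2) J(2) g_sym unfolding M_def by blast
    qed
    \<comment> \<open>\<open>X\<close> and \<open>M\<close> cover \<open>T\<close>, so nothing
      leaves \<open>K - X\<close> except into \<open>X\<close>, and \<open>r K\<close> keeps
      \<open>K - X\<close> nonempty. A vertex of \<open>J\<close> adds one member and at most
      \<open>b\<close> vertices of \<open>X\<close>, so it cancels from the toughness
      inequality.\<close>
    define X where "X = S \<union> (\<Union>v\<in>M. N v) \<union> D \<union> TG"
    have MX: "v \<notin> X" if "v \<in> M" for v
    proof -
      have "v \<in> I \<or> v \<in> J" using that by (simp add: M_def)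
      then have "v \<notin> D \<union> TG" using IT(3)[of v] JT(3,5)[of v] by (auto simp: D_def TG_def TE_def)
      then show ?thesis using MT[OF that] indM[OF _ that] by (auto simp: X_def N_def)
    qed
    have TX: "v \<in> X \<union> M" if v: "v \<in> T" for v
    proof -
      have nbX: "v \<in> X" if "u \<in> M" "g u v" for u
        using that v ST by (auto simp: X_def N_def)
      consider "v \<in> TL" | "v \<in> TG" | "v \<in> NI" | "v \<in> D" | "v \<in> Rest"
        using v unfolding TL_def TG_def D_def Rest_def TE_def mem_Collect_eq by (meson linorder_less_linear)
      then show ?thesis
      proof cases
        case 1
        then show ?thesis using I(3) nbX by (auto simp: M_def)
      next
        case 5
        then show ?thesis using J(3) nbX by (auto simp: M_def)
      qed (auto simp: X_def NI_def M_def)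
    qed
    have rX: "r K \<in> K - X" if K: "K \<in> Q" for K
    proof -
      have KC: "K \<in> C" "r K \<notin> NI" using K by (auto simp: Q_def L_def)
      have "r K \<notin> S \<union> T" using r(1)[OF KC(1)] CST[OF KC(1)] by blast
      moreover have "r K \<notin> N v" if "v \<in> J" for v
        using JT(5)[OF that K] g_sym by (auto simp: N_def)
      moreover have "D \<union> TG \<subseteq> T" by (auto simp: D_def TG_def TE_def)
      ultimately show ?thesis using r(1)[OF KC(1)] KC(2) by (auto simp: X_def M_def NI_def)
    qed
    define A where "A = (\<lambda>v. {v}) ` M"
    define B where "B = (\<lambda>K. K - X) ` Q"
    have QC: "Q \<subseteq> C" by (auto simp: Q_def)
    have AB: "P \<inter> P' = {}" if "P \<in> A" "P' \<in> B" for P P'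
      using that MT CST QC by (auto simp: A_def B_def)
    have "closed_family g X (A \<union> B)"
      unfolding closed_family_def
    proof (intro conjI ballI allI impI)
      show "disjoint (A \<union> B)"
        unfolding disjoint_def
      proof (intro ballI impI)
        fix P P' assume P: "P \<in> A \<union> B" "P' \<in> A \<union> B" "P \<noteq> P'"
        consider "P \<in> A" "P' \<in> A" | "P \<in> B" "P' \<in> B" | "P \<in> A" "P' \<in> B" | "P' \<in> A" "P \<in> B"
          using P by blast
        then show "P \<inter> P' = {}"
        proof cases
          case 2
          then obtain K K' where "K \<in> C" "K' \<in> C" "P = K - X" "P' = K' - X" using QC by (auto simp: B_def)
          moreover from this have "K \<noteq> K'" using P(3) by auto
          ultimately show ?thesis using disC by (auto simp: disjoint_def)
        qed (use P(3) AB in \<open>auto simp: A_def\<close>)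
      qed
      show "{} \<notin> A \<union> B" using rX by (auto simp: A_def B_def)
      fix P assume P: "P \<in> A \<union> B"
      then show "P \<inter> X = {}" using MX by (auto simp: A_def B_def)
      fix u v assume uv: "u \<in> P" "g u v"
      show "v \<in> P \<union> X"
      proof (cases "P \<in> A")
        case True
        then have "u \<in> M" using uv by (auto simp: A_def)
        then show ?thesis using uv(2) by (auto simp: X_def N_def)
      next
        case False
        then obtain K where K: "K \<in> Q" "P = K - X" using P by (auto simp: B_def)
        then have u: "u \<in> K" "u \<notin> X" "u \<notin> S" using uv(1) by (auto simp: X_def)
        have "v \<notin> M" using u uv(2) g_sym by (auto simp: X_def N_def)
        moreover have "v \<in> K \<union> S \<union> T" using Ccl[of K u v] K QC u uv(2) by blast
        ultimately show ?thesis using TX[of v] K(2) by (auto simp: X_def)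
      qed
    qed
    moreover have cAB: "card (A \<union> B) = card I + card J + card Q"
    proof -
      have "A \<inter> B = {}" using AB by (force simp: A_def)
      then have "card (A \<union> B) = card A + card B" by (intro card_Un_disjoint) auto
      moreover have "card A = card M" by (simp add: A_def sing_inj)
      moreover have "card M = card I + card J"
        unfolding M_def using IT(3) JT(3) by (intro card_Un_disjoint) fastforce+
      moreover have "inj_on (\<lambda>K. K - X) Q"
      proof (rule inj_onI)
        fix K K' assume K: "K \<in> Q" "K' \<in> Q" "K - X = K' - X"
        then have "r K \<in> K'" using rX[OF K(1)] by auto
        then show "K = K'" using r_inj[of K K'] K QC by blast
      qed
      ultimately show ?thesis by (simp add: B_def card_image)
    qed
    ultimately have "(b * (a - 1) + a) * (card I + card J + card Q) \<le> b * card X"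
      using tough[of X "A \<union> B"] q by simp
    moreover have "b * (a - 1) + a = b * b" using ab a_pos by (cases b) auto
    ultimately have "b * (b * (card I + card J + card Q)) \<le> b * card X" by (simp add: mult.assoc)
    then have "b * (card I + card J + card Q) \<le> card X" using b_pos by simp
    also have "card X \<le> card S + card (\<Union>v\<in>M. N v) + card D + card TG"
      unfolding X_def by (intro order_trans[OF card_Un_le] add_right_mono) (rule order_refl)+
    also have "card (\<Union>v\<in>M. N v) \<le> (\<Sum>v\<in>M. d v)" using card_UN_le[of M N] by (simp add: dN)
    also have "(\<Sum>v\<in>M. d v) = (\<Sum>v\<in>I. d v) + (\<Sum>v\<in>J. d v)"
      unfolding M_def using IT(3) JT(3) by (intro sum.union_disjoint) fastforce+
    also have "(\<Sum>v\<in>J. d v) = b * card J" using JT(3) ab by simp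
    finally have "b * (card I + card J + card Q) \<le> card S + ((\<Sum>v\<in>I. d v) + b * card J) + (b - 1) * card Q + card TG"
      using cD by linarith
    moreover have "b * card Q = (b - 1) * card Q + card Q" using b_pos by (cases b) auto
    ultimately have "b * card I + card Q \<le> card S + (\<Sum>v\<in>I. d v) + card TG"
      by (simp add: add_mult_distrib2)
    then have "b * (b * card I + card Q) \<le> b * (card S + (\<Sum>v\<in>I. d v) + card TG)" by (rule mult_left_mono) simp
    moreover have "(\<Sum>v\<in>I. w v) + b * (\<Sum>v\<in>I. d v) = b * (b * card I)"
    proof -
      have "w v + b * d v = b * b" if "v \<in> I" for v
      proof -
        have "b = (a - 1 - d v) + d v + 1" using IT(3)[OF that] ab by simp
        then have "b * b = b * (a - 1 - d v) + b * d v + b" by (metis add_mult_distrib2 mult_1_right)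
        then show ?thesis using ab by (simp add: w_def)
      qed
      then have "(\<Sum>v\<in>I. w v + b * d v) = b * b * card I" by simp
      then show ?thesis by (simp add: sum.distrib sum_distrib_left mult.assoc)
    qed
    ultimately have "(\<Sum>v\<in>I. w v) + b * card Q \<le> b * card S + b * card TG"
      by (simp add: add_mult_distrib2)
    \<comment> \<open>The barrier and toughness together would give
      \<open>(b - 1) * card Q + 2 \<le> (b - 1) * card TG\<close>, although \<open>Q\<close> is
      larger than \<open>TG\<close>.\<close>
    with main' have "b * card Q + card TG + 2 \<le> b * card TG + card Q" by linarith
    moreover have "(b - 1) * card TG \<le> (b - 1) * card Q" using q by simp
    moreover have "b * card Q = (b - 1) * card Q + card Q" "b * card TG = (b - 1) * card TG + card TG"
      using b_pos by (cases b; simp)+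
    ultimately show False by linarith
  qed
qed

end

subsection \<open>The theorem\<close>

lemma factor_gadget_adj:
  assumes "simple_graph E" "a \<le> b" "0 < b" "a < b \<or> even (b * CARD('v))"
  shows "factor_gadget (adj (E :: 'v::finite set set)) a b"
  using assms simple_graph_irrefl[OF assms(1)] by unfold_locales (auto simp: insert_commute)

lemma adj_of_symmetric_relation:
  assumes "\<And>u v. h u v \<Longrightarrow> h v u"
  shows "adj {{u, v} | u v. h u v} u v \<longleftrightarrow> h u v"
  using assms by (auto simp: doubleton_eq_iff)

theorem theorem7:
  fixes E :: "'v::finite set set" and a b :: nat
  assumes "simple_graph E"
    and "E \<noteq> {}"
    and "0 < a" and "a \<le> b"
    and "a < b \<or> even (b * CARD('v))"
    and "a < CARD('v)"
    and "mu E 2 / mu E (CARD('v)) \<ge> 1 - real b / (real a * (real b + 1))"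
  shows "\<exists>H. is_factor a b E H"
proof (rule ccontr)
  assume no: "\<nexists>H. is_factor a b E H"
  interpret factor_gadget "adj E" a b
    using assms by (intro factor_gadget_adj) auto
  define \<mu> \<nu> where "\<mu> = mu E 2" and "\<nu> = mu E CARD('v)"
  define p where "p = real (b * (a - 1) + a)"
  have p: "p = real b * (real a - 1) + real a"
    using assms(3) by (simp add: p_def of_nat_diff)
  have p_pos: "0 < p" unfolding p_def of_nat_0_less_iff using assms(3) by simp
  have n2: "CARD('v) \<ge> 2" using assms(3,6) by linarith
  have \<mu>: "0 \<le> \<mu>" using laplacian_eigenvalue_bounds(1)[OF assms(1) n2] by (simp add: \<mu>_def)
  have pb: "real a * (real b + 1) = p + b" by (simp add: p algebra_simps)
  have "1 - b / (p + b) = p / (p + b)" using p_pos by (simp add: field_simps)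
  then have ratio: "p / (p + b) \<le> \<mu> / \<nu>"
    using assms(7) by (simp add: pb \<mu>_def \<nu>_def)
  have "0 < p / (p + b)" using p_pos by simp
  \<comment> \<open>Since \<open>x / 0 = 0\<close>, positivity of the quotient also rules out
    \<open>\<nu> = 0\<close>.\<close>
  then have "0 < \<mu> / \<nu>" using ratio by linarith
  then have pos: "0 < \<mu>" "0 < \<nu>" using \<mu> by (auto simp: zero_less_divide_iff)
  then have "p * \<nu> \<le> \<mu> * (p + b)" using ratio p_pos by (simp add: field_simps)
  then have gap: "p * (\<nu> - \<mu>) \<le> \<mu> * b" by (simp add: algebra_simps)
  have tough: "(b * (a - 1) + a) * card F \<le> b * card X" if F: "closed_family (adj E) X F" "2 \<le> card F" for X F
  proof -
    from laplacian_toughness[OF assms(1) F]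
    have "p * (\<mu> * card F) \<le> p * ((\<nu> - \<mu>) * card X)"
      using p_pos by (intro mult_left_mono) (auto simp: \<mu>_def \<nu>_def)
    also have "\<dots> \<le> (\<mu> * b) * card X"
      unfolding mult.assoc[symmetric] using gap by (intro mult_right_mono) auto
    finally have "\<mu> * (p * card F) \<le> \<mu> * (b * card X)" by (simp add: mult_ac)
    then have "p * card F \<le> b * card X" using pos(1) by simp
    then show ?thesis unfolding p_def by (simp only: of_nat_mult[symmetric] of_nat_le_iff)
  qed
  have deg: "a \<le> card (nb v)" for v
  proof (cases "nb v = UNIV - {v}")
    \<comment> \<open>The neighbourhood of such a vertex separates nothing, and a complete graph on
      at least two vertices has eigenvalue ratio 1 for every \<open>a\<close>; the degree bound
      comes from \<open>a < CARD('v)\<close>.\<close>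
    case True
    then show ?thesis using assms(6) by simp
  next
    case False
    define Y where "Y = UNIV - {v} - nb v"
    have v: "v \<notin> nb v" using g_irrefl by (simp add: nb_def)
    then have Y: "Y \<noteq> {}" "v \<notin> Y" using False by (auto simp: Y_def)
    \<comment> \<open>The neighbours of \<open>v\<close> separate it from \<open>Y\<close>, and
      toughness demands more of them than \<open>2 * (a - 1)\<close>.\<close>
    have closed: "closed_family (adj E) (nb v) {{v}, Y}"
      using v Y g_sym by (auto simp: closed_family_def disjoint_def Y_def nb_def)
    have "card {{v}, Y} = 2" using Y by (auto simp: card_2_iff)
    then have *: "(b * (a - 1) + a) * 2 \<le> b * card (nb v)" using tough[OF closed] by simp
    show ?thesis
    proof (rule ccontr)
      assume "\<not> a \<le> card (nb v)"
      then have "card (nb v) \<le> a - 1" by linarith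
      then have upper: "b * card (nb v) \<le> b * (a - 1)" by (rule mult_le_mono2)
      define k where "k = b * (a - 1)"
      have "(k + a) * 2 \<le> k" unfolding k_def using * upper by (rule order_trans)
      then show False using assms(3) by simp
    qed
  qed
  have False if h: "\<And>u v. h u v \<Longrightarrow> adj E u v" "\<And>u v. h u v \<Longrightarrow> h v u"
    "\<And>v. a \<le> card {u. h v u} \<and> card {u. h v u} \<le> b" for h
  proof -
    define H where "H = {{u, v} | u v. h u v}"
    have HE: "H \<subseteq> E" using h(1) by (auto simp: H_def)
    then have "simple_graph H" using assms(1) by (auto simp: simple_graph_def)
    then have "vdegree H v = card {u. h v u}" for v
      using adj_of_symmetric_relation[of h, OF h(2)] by (simp add: vdegree_eq_card_nbrs H_def)
    then have "is_factor a b E H" using HE h(3) by (simp add: is_factor_def)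
    then show False using no by blast
  qed
  then obtain S T C where "factor_barrier S T C" using factor_or_barrier by blast
  then show False using tough_no_barrier[OF assms(3) deg tough] by blast
qed

end
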